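(* Let $G$ be any countable discrete maximally almost periodic group and let $A$ be any UHF algebra. Then there exists a strongly outer product type action $\alpha$ of $G$ on $A$.
   Context: A discrete group $G$ is maximally almost periodic if for every $g\in G\setminus\{1\}$ there are $n\in\mathbb{N}$ and a group homomorphism $\varphi:G\to U(M_n)$ (unitary group of $M_n=M_n(\mathbb{C})$) with $\varphi(g)\neq 1$. A UHF algebra is a $C^*$-algebra isomorphic to an infinite tensor product $M_{(n_l)_{l\in\mathbb{N}}}=M_{n_1}\otimes M_{n_2}\otimes\cdots$ for some sequence $(n_l)_{l\in\mathbb{N}}$ of integers, each at least $2$; it has a unique tracial state $\tau$. Let $\mathrm{Ad}:\prod_{l}U(M_{n_l})\to\mathrm{Aut}\,M_{(n_l)_{l\in\mathbb{N}}}$ be the homomorphism $(u_l)_l\mapsto\bigotimes_l\mathrm{Ad}\,u_l$. An action of $G$ on a UHF algebra $A$ is a product type action if, for some sequence $(n_l)_{l\in\mathbb{N}}$ of positive integers and some identification $A\cong M_{(n_l)_{l\in\mathbb{N}}}$, it is given by a composition of group homomorphisms $G\to\prod_{l=1}^\infty U(M_{n_l})\xrightarrow{\mathrm{Ad}}\mathrm{Aut}\,M_{(n_l)_{l\in\mathbb{N}}}$. Let $\pi_\tau$ be the GNS representation of the tracial state $\tau$ of $A$. An automorphism of $A$ is weakly inner if its extension to the von Neumann algebra $\pi_\tau(A)''$ equals $\mathrm{Ad}\,u$ for some unitary $u\in\pi_\tau(A)''$. An action $\alpha$ of $G$ on $A$ is strongly outer if $\alpha_g$ is not weakly inner for every $g\in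 G\setminus\{1\}$. *)

theory Defs
  imports
    "HOL-Analysis.Analysis"
    "HOL-Algebra.Product_Groups"
    "Jordan_Normal_Form.Schur_Decomposition"
begin

section \<open>Matrix algebras and unitary groups\<close>

text \<open>Matrices are those of \<^theory>\<open>Jordan_Normal_Form.Matrix\<close>; \<open>mat_adjoint\<close> is the
  conjugate transpose.\<close>

definition unitary_group :: "nat \<Rightarrow> complex mat monoid" where
  "unitary_group n =
     \<lparr> carrier = {U \<in> carrier_mat n n. mat_adjoint U * U = 1\<^sub>m n \<and> U * mat_adjoint U = 1\<^sub>m n},
       monoid.mult = (*), one = 1\<^sub>m n \<rparr>"

definition maximally_almost_periodic :: "('g, 'm) monoid_scheme \<Rightarrow> bool" where
  "maximally_almost_periodic G \<longleftrightarrow>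
     (\<forall>g \<in> carrier G - {\<one>\<^bsub>G\<^esub>}. \<exists>n. \<exists>\<phi> \<in> hom G (unitary_group n). \<phi> g \<noteq> \<one>\<^bsub>unitary_group n\<^esub>)"

definition vec_l2norm :: "complex vec \<Rightarrow> real" where
  "vec_l2norm v = sqrt (Re (scalar_prod v (conjugate v)))"

text \<open>The C*-norm of the matrix algebra: the operator norm for the Euclidean norm.\<close>
definition mat_opnorm :: "complex mat \<Rightarrow> real" where
  "mat_opnorm a = (SUP v \<in> {v \<in> carrier_vec (dim_col a). vec_l2norm v \<le> 1}. vec_l2norm (a *\<^sub>v v))"

text \<open>The Kronecker product identifies \<open>M\<^sub>p \<otimes> M\<^sub>q\<close> with \<open>M\<^sub>p\<^sub>q\<close>.\<close>
definition kron :: "complex mat \<Rightarrow> complex mat \<Rightarrow> complex mat" where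
  "kron A B = Matrix.mat (dim_row A * dim_row B) (dim_col A * dim_col B)
     (\<lambda>(i, j). A $$ (i div dim_row B, j div dim_col B) * B $$ (i mod dim_row B, j mod dim_col B))"

text \<open>\<open>kron_upto u k\<close> is \<open>u 0 \<otimes> \<dots> \<otimes> u (k - 1)\<close>.\<close>
primrec kron_upto :: "(nat \<Rightarrow> complex mat) \<Rightarrow> nat \<Rightarrow> complex mat" where
  "kron_upto u 0 = 1\<^sub>m 1"
| "kron_upto u (Suc k) = kron (kron_upto u k) (u k)"

section \<open>Unital C*-algebras and their automorphisms\<close>

class cstar_algebra = real_normed_algebra_1 + banach +
  fixes scaleC :: "complex \<Rightarrow> 'a \<Rightarrow> 'a" (infixr \<open>*\<^sub>C\<close> 75)
    and star :: "'a \<Rightarrow> 'a"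
  assumes scaleC_add_right: "c *\<^sub>C (x + y) = c *\<^sub>C x + c *\<^sub>C y"
    and scaleC_add_left: "(c + d) *\<^sub>C x = c *\<^sub>C x + d *\<^sub>C x"
    and scaleC_scaleC: "c *\<^sub>C d *\<^sub>C x = (c * d) *\<^sub>C x"
    and scaleC_of_real: "complex_of_real r *\<^sub>C x = r *\<^sub>R x"
    and mult_scaleC_left: "(c *\<^sub>C x) * y = c *\<^sub>C (x * y)"
    and mult_scaleC_right: "x * (c *\<^sub>C y) = c *\<^sub>C (x * y)"
    and norm_scaleC: "norm (c *\<^sub>C x) = cmod c * norm x"
    and star_star: "star (star x) = x"
    and star_add: "star (x + y) = star x + star y"
    and star_scaleC: "star (c *\<^sub>C x) = cnj c *\<^sub>C star x"
    and star_mult: "star (x * y) = star y * star x"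
    and cstar_identity: "norm (star x * x) = (norm x)\<^sup>2"

definition star_automorphism :: "('a::cstar_algebra \<Rightarrow> 'a) \<Rightarrow> bool" where
  "star_automorphism f \<longleftrightarrow> bij f \<and>
     (\<forall>x y. f (x + y) = f x + f y) \<and> (\<forall>c x. f (c *\<^sub>C x) = c *\<^sub>C f x) \<and>
     (\<forall>x y. f (x * y) = f x * f y) \<and> (\<forall>x. f (star x) = star (f x))"

definition Aut_group :: "('a::cstar_algebra \<Rightarrow> 'a) monoid" where
  "Aut_group = \<lparr> carrier = {f. star_automorphism f}, monoid.mult = (\<circ>), one = id \<rparr>"

section \<open>Infinite tensor products, UHF algebras and product type actions\<close>

text \<open>Isometric unital *-homomorphisms from \<open>M\<^sub>d\<close>. (An injective *-homomorphism between
  C*-algebras is automatically isometric.)\<close>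
definition matrix_embedding :: "nat \<Rightarrow> (complex mat \<Rightarrow> 'a::cstar_algebra) \<Rightarrow> bool" where
  "matrix_embedding d \<phi> \<longleftrightarrow>
     (\<forall>a \<in> carrier_mat d d. \<forall>b \<in> carrier_mat d d. \<phi> (a + b) = \<phi> a + \<phi> b \<and> \<phi> (a * b) = \<phi> a * \<phi> b) \<and>
     (\<forall>c. \<forall>a \<in> carrier_mat d d. \<phi> (c \<cdot>\<^sub>m a) = c *\<^sub>C \<phi> a) \<and>
     (\<forall>a \<in> carrier_mat d d. \<phi> (mat_adjoint a) = star (\<phi> a) \<and> norm (\<phi> a) = mat_opnorm a) \<and>
     \<phi> (1\<^sub>m d) = 1"

text \<open>The infinite tensor product \<open>M\<^bsub>n 0\<^esub> \<otimes> M\<^bsub>n 1\<^esub> \<otimes> \<dots>\<close> is the C*-completion of the inductive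
  limit of the finite tensor products \<open>M\<^bsub>n 0\<^esub> \<otimes> \<dots> \<otimes> M\<^bsub>n (k - 1)\<^esub>\<close> along \<open>a \<mapsto> a \<otimes> 1\<close>.
  An identification of the C*-algebra \<open>'a\<close> with it is thus given by the images \<open>\<iota> k\<close> of these
  finite stages: compatible isometric embeddings whose union is dense.\<close>
definition inf_tensor_identification ::
    "(nat \<Rightarrow> nat) \<Rightarrow> (nat \<Rightarrow> complex mat \<Rightarrow> 'a::cstar_algebra) \<Rightarrow> bool" where
  "inf_tensor_identification n \<iota> \<longleftrightarrow>
     (\<forall>k. matrix_embedding (\<Prod>l<k. n l) (\<iota> k)) \<and>
     (\<forall>k. \<forall>a \<in> carrier_mat (\<Prod>l<k. n l) (\<Prod>l<k. n l). \<iota> (Suc k) (kron a (1\<^sub>m (n k))) = \<iota> k a) \<and>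
     closure (\<Union>k. \<iota> k ` carrier_mat (\<Prod>l<k. n l) (\<Prod>l<k. n l)) = UNIV"

definition uhf_algebra :: "'a::cstar_algebra itself \<Rightarrow> bool" where
  "uhf_algebra _ \<longleftrightarrow>
     (\<exists>n (\<iota> :: nat \<Rightarrow> complex mat \<Rightarrow> 'a). (\<forall>l. n l \<ge> 2) \<and> inf_tensor_identification n \<iota>)"

text \<open>\<open>f\<close> corresponds to \<open>\<Otimes>\<^sub>l Ad (u l)\<close> under the identification \<open>\<iota>\<close>. Since the finite stages
  are dense, this determines the automorphism \<open>f\<close>.\<close>
definition is_tensor_Ad ::
    "(nat \<Rightarrow> nat) \<Rightarrow> (nat \<Rightarrow> complex mat \<Rightarrow> 'a::cstar_algebra) \<Rightarrow> (nat \<Rightarrow> complex mat) \<Rightarrow> ('a \<Rightarrow> 'a) \<Rightarrow> bool"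
  where
  "is_tensor_Ad n \<iota> u f \<longleftrightarrow> star_automorphism f \<and>
     (\<forall>k. \<forall>a \<in> carrier_mat (\<Prod>l<k. n l) (\<Prod>l<k. n l).
        f (\<iota> k a) = \<iota> k (kron_upto u k * a * mat_adjoint (kron_upto u k)))"

definition product_type_action ::
    "('g, 'm) monoid_scheme \<Rightarrow> ('g \<Rightarrow> 'a::cstar_algebra \<Rightarrow> 'a) \<Rightarrow> bool" where
  "product_type_action G \<alpha> \<longleftrightarrow> \<alpha> \<in> hom G Aut_group \<and>
     (\<exists>n \<iota>. (\<forall>l. n l \<ge> 1) \<and> inf_tensor_identification n \<iota> \<and>
        (\<exists>\<rho> \<in> hom G (product_group UNIV (\<lambda>l. unitary_group (n l))).
           \<forall>g \<in> carrier G. is_tensor_Ad n \<iota> (\<rho> g) (\<alpha> g)))"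

section \<open>Tracial states and the GNS representation\<close>

text \<open>The bound \<open>cmod (\<tau> x) \<le> norm x\<close> together with \<open>\<tau> 1 = 1\<close> says that \<open>\<tau>\<close> has norm one.\<close>
definition tracial_state :: "('a::cstar_algebra \<Rightarrow> complex) \<Rightarrow> bool" where
  "tracial_state \<tau> \<longleftrightarrow>
     (\<forall>x y. \<tau> (x + y) = \<tau> x + \<tau> y) \<and> (\<forall>c x. \<tau> (c *\<^sub>C x) = c * \<tau> x) \<and>
     (\<forall>x. cmod (\<tau> x) \<le> norm x) \<and> \<tau> 1 = 1 \<and> (\<forall>x. \<tau> (star x * x) \<in> \<real>\<^sub>\<ge>\<^sub>0) \<and>
     (\<forall>x y. \<tau> (x * y) = \<tau> (y * x))"

text \<open>Meaningful for algebras with exactly one tracial state, such as UHF algebras.\<close>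
definition the_trace :: "'a::cstar_algebra \<Rightarrow> complex" where
  "the_trace = (THE \<tau>. tracial_state \<tau>)"

text \<open>The GNS space of \<open>\<tau>\<close> is the completion of \<open>A\<close> for the seminorm below (with null vectors
  divided out): classes of Cauchy sequences modulo null sequences.\<close>

definition gns_seminorm :: "('a::cstar_algebra \<Rightarrow> complex) \<Rightarrow> 'a \<Rightarrow> real" where
  "gns_seminorm \<tau> x = sqrt (Re (\<tau> (star x * x)))"

definition gns_Cauchy :: "('a::cstar_algebra \<Rightarrow> complex) \<Rightarrow> (nat \<Rightarrow> 'a) set" where
  "gns_Cauchy \<tau> = {X. \<forall>e>0. \<exists>N. \<forall>m\<ge>N. \<forall>n\<ge>N. gns_seminorm \<tau> (X m - X n) < e}"

definition gns_rel :: "('a::cstar_algebra \<Rightarrow> complex) \<Rightarrow> (nat \<Rightarrow> 'a) rel" where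
  "gns_rel \<tau> = {(X, Y). X \<in> gns_Cauchy \<tau> \<and> Y \<in> gns_Cauchy \<tau> \<and>
                        (\<lambda>n. gns_seminorm \<tau> (X n - Y n)) \<longlonglongrightarrow> 0}"

definition gns_space :: "('a::cstar_algebra \<Rightarrow> complex) \<Rightarrow> (nat \<Rightarrow> 'a) set set" where
  "gns_space \<tau> = gns_Cauchy \<tau> // gns_rel \<tau>"

definition gns_add ::
    "('a::cstar_algebra \<Rightarrow> complex) \<Rightarrow> (nat \<Rightarrow> 'a) set \<Rightarrow> (nat \<Rightarrow> 'a) set \<Rightarrow> (nat \<Rightarrow> 'a) set" where
  "gns_add \<tau> \<xi> \<eta> = (\<Union>X\<in>\<xi>. \<Union>Y\<in>\<eta>. gns_rel \<tau> `` {\<lambda>n. X n + Y n})"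

definition gns_scale ::
    "('a::cstar_algebra \<Rightarrow> complex) \<Rightarrow> complex \<Rightarrow> (nat \<Rightarrow> 'a) set \<Rightarrow> (nat \<Rightarrow> 'a) set" where
  "gns_scale \<tau> c \<xi> = (\<Union>X\<in>\<xi>. gns_rel \<tau> `` {\<lambda>n. c *\<^sub>C X n})"

text \<open>The inner product is linear in its second argument. The limit exists and does not depend
  on the representatives, so the image is a singleton.\<close>
definition gns_inner ::
    "('a::cstar_algebra \<Rightarrow> complex) \<Rightarrow> (nat \<Rightarrow> 'a) set \<Rightarrow> (nat \<Rightarrow> 'a) set \<Rightarrow> complex" where
  "gns_inner \<tau> \<xi> \<eta> = the_elem ((\<lambda>(X, Y). lim (\<lambda>n. \<tau> (star (X n) * Y n))) ` (\<xi> \<times> \<eta>))"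

definition gns_norm :: "('a::cstar_algebra \<Rightarrow> complex) \<Rightarrow> (nat \<Rightarrow> 'a) set \<Rightarrow> real" where
  "gns_norm \<tau> \<xi> = sqrt (Re (gns_inner \<tau> \<xi> \<xi>))"

type_synonym 'a gns_op = "(nat \<Rightarrow> 'a) set \<Rightarrow> (nat \<Rightarrow> 'a) set"

text \<open>Bounded operators are extensional functions on the GNS space, so that equality of operators
  is equality of functions and composition is \<open>compose (gns_space \<tau>)\<close>.\<close>
definition gns_bounded :: "('a::cstar_algebra \<Rightarrow> complex) \<Rightarrow> 'a gns_op set" where
  "gns_bounded \<tau> = {T \<in> gns_space \<tau> \<rightarrow>\<^sub>E gns_space \<tau>.
     (\<forall>\<xi> \<in> gns_space \<tau>. \<forall>\<eta> \<in> gns_space \<tau>. T (gns_add \<tau> \<xi> \<eta>) = gns_add \<tau> (T \<xi>) (T \<eta>)) \<and>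
     (\<forall>c. \<forall>\<xi> \<in> gns_space \<tau>. T (gns_scale \<tau> c \<xi>) = gns_scale \<tau> c (T \<xi>)) \<and>
     (\<exists>K. \<forall>\<xi> \<in> gns_space \<tau>. gns_norm \<tau> (T \<xi>) \<le> K * gns_norm \<tau> \<xi>)}"

definition gns_op_id :: "('a::cstar_algebra \<Rightarrow> complex) \<Rightarrow> 'a gns_op" where
  "gns_op_id \<tau> = restrict (\<lambda>\<xi>. \<xi>) (gns_space \<tau>)"

definition gns_op_add :: "('a::cstar_algebra \<Rightarrow> complex) \<Rightarrow> 'a gns_op \<Rightarrow> 'a gns_op \<Rightarrow> 'a gns_op" where
  "gns_op_add \<tau> S T = restrict (\<lambda>\<xi>. gns_add \<tau> (S \<xi>) (T \<xi>)) (gns_space \<tau>)"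

definition gns_op_scale :: "('a::cstar_algebra \<Rightarrow> complex) \<Rightarrow> complex \<Rightarrow> 'a gns_op \<Rightarrow> 'a gns_op" where
  "gns_op_scale \<tau> c T = restrict (\<lambda>\<xi>. gns_scale \<tau> c (T \<xi>)) (gns_space \<tau>)"

abbreviation gns_op_mult :: "('a::cstar_algebra \<Rightarrow> complex) \<Rightarrow> 'a gns_op \<Rightarrow> 'a gns_op \<Rightarrow> 'a gns_op" where
  "gns_op_mult \<tau> \<equiv> compose (gns_space \<tau>)"

text \<open>\<open>is_gns_adjoint \<tau> T S\<close>: the bounded operator \<open>S\<close> is the Hilbert space adjoint of \<open>T\<close>.\<close>
definition is_gns_adjoint :: "('a::cstar_algebra \<Rightarrow> complex) \<Rightarrow> 'a gns_op \<Rightarrow> 'a gns_op \<Rightarrow> bool" where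
  "is_gns_adjoint \<tau> T S \<longleftrightarrow> T \<in> gns_bounded \<tau> \<and> S \<in> gns_bounded \<tau> \<and>
     (\<forall>\<xi> \<in> gns_space \<tau>. \<forall>\<eta> \<in> gns_space \<tau>. gns_inner \<tau> (T \<xi>) \<eta> = gns_inner \<tau> \<xi> (S \<eta>))"

definition gns_rep :: "('a::cstar_algebra \<Rightarrow> complex) \<Rightarrow> 'a \<Rightarrow> 'a gns_op" where
  "gns_rep \<tau> a = restrict (\<lambda>\<xi>. \<Union>X\<in>\<xi>. gns_rel \<tau> `` {\<lambda>n. a * X n}) (gns_space \<tau>)"

definition gns_commutant :: "('a::cstar_algebra \<Rightarrow> complex) \<Rightarrow> 'a gns_op set \<Rightarrow> 'a gns_op set" where
  "gns_commutant \<tau> \<S> = {T \<in> gns_bounded \<tau>. \<forall>S \<in> \<S>. gns_op_mult \<tau> T S = gns_op_mult \<tau> S T}"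

definition gns_vN :: "('a::cstar_algebra \<Rightarrow> complex) \<Rightarrow> 'a gns_op set" where
  "gns_vN \<tau> = gns_commutant \<tau> (gns_commutant \<tau> (range (gns_rep \<tau>)))"

section \<open>Weakly inner automorphisms and strongly outer actions\<close>

text \<open>\<open>\<psi>\<close> is a *-automorphism of the von Neumann algebra extending \<open>f\<close>. Automorphisms of von Neumann
  algebras are automatically normal, so there is at most one such \<open>\<psi>\<close> on \<open>gns_vN \<tau>\<close>.\<close>
definition vN_extension ::
    "('a::cstar_algebra \<Rightarrow> complex) \<Rightarrow> ('a \<Rightarrow> 'a) \<Rightarrow> ('a gns_op \<Rightarrow> 'a gns_op) \<Rightarrow> bool" where
  "vN_extension \<tau> f \<psi> \<longleftrightarrow>
     bij_betw \<psi> (gns_vN \<tau>) (gns_vN \<tau>) \<and>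
     (\<forall>S \<in> gns_vN \<tau>. \<forall>T \<in> gns_vN \<tau>.
        \<psi> (gns_op_add \<tau> S T) = gns_op_add \<tau> (\<psi> S) (\<psi> T) \<and>
        \<psi> (gns_op_mult \<tau> S T) = gns_op_mult \<tau> (\<psi> S) (\<psi> T) \<and>
        (is_gns_adjoint \<tau> S T \<longrightarrow> is_gns_adjoint \<tau> (\<psi> S) (\<psi> T))) \<and>
     (\<forall>c. \<forall>T \<in> gns_vN \<tau>. \<psi> (gns_op_scale \<tau> c T) = gns_op_scale \<tau> c (\<psi> T)) \<and>
     (\<forall>a. \<psi> (gns_rep \<tau> a) = gns_rep \<tau> (f a))"

text \<open>Below \<open>v\<close> is the adjoint of \<open>u\<close>, so \<open>u\<close> is unitary and \<open>\<psi>\<close> is \<open>Ad u\<close>.\<close>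
definition weakly_inner :: "('a::cstar_algebra \<Rightarrow> complex) \<Rightarrow> ('a \<Rightarrow> 'a) \<Rightarrow> bool" where
  "weakly_inner \<tau> f \<longleftrightarrow>
     (\<exists>\<psi>. vN_extension \<tau> f \<psi> \<and>
        (\<exists>u \<in> gns_vN \<tau>. \<exists>v. is_gns_adjoint \<tau> u v \<and>
           gns_op_mult \<tau> u v = gns_op_id \<tau> \<and> gns_op_mult \<tau> v u = gns_op_id \<tau> \<and>
           (\<forall>T \<in> gns_vN \<tau>. \<psi> T = gns_op_mult \<tau> u (gns_op_mult \<tau> T v))))"

definition strongly_outer ::
    "('g, 'm) monoid_scheme \<Rightarrow> ('g \<Rightarrow> 'a::cstar_algebra \<Rightarrow> 'a) \<Rightarrow> bool" where
  "strongly_outer G \<alpha> \<longleftrightarrow> (\<forall>g \<in> carrier G - {\<one>\<^bsub>G\<^esub>}. \<not> weakly_inner the_trace (\<alpha> g))"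

end

(* An automorphism Ad(u_1) (x) Ad(u_2) (x) ... of an infinite tensor product cannot be weakly
   inner if, for infinitely many j, some unitary b in the j-th factor is moved by Ad(u_j) by at least a fixed
   amount in the normalised Hilbert-Schmidt norm. Indeed, if w in the GNS space implements it, so
   that w b = Ad(u_j)(b) w, then approximating w by an element of a finite stage, which
   commutes with b and is independent of it for the trace, gives a contradiction.

   To reach this situation for every nontrivial g, enumerate G so that every element occurs
   infinitely often, group the tensor factors of A into blocks, the j-th one of dimension N at least
   twice the dimension d of a representation phi that detects the j-th element, and let
   G act on the j-th block by N div (2d) copies of phi plus a trivial representation. *)
theory Submission
  imports Defs
begin

section \<open>Kronecker products and adjoints\<close>

text \<open>Conjugation forgets scalars, so phi(g) may be a nontrivial scalar that \<open>Ad\<close>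
  cannot see. The trivial summand removes this obstacle: for a unitary b swapping copies of phi with
  trivial coordinates, one corner of b - Ad(u_j)(b) consists of copies of 1 - phi(g) itself. The
  dimensions of the tensor factors are dictated by A and may be unbounded. A single copy of phi,
  padded trivially, would have a normalised defect of order 1/N; filling about half of the
  coordinates leaves a bound that depends on g alone. Recurrence of g is forced by the order of the
  choices: the finite stage approximating w is fixed first, and some block beyond it must still
  detect g. The von Neumann algebra enters only through the vector w = u 1. Right multiplications
  act isometrically on the GNS space because the state is a trace, they commute with u, and this
  yields the relation for w. As the trace is given by a definite description, its existence and
  uniqueness are part of the argument; both come from the finite stages by density.\<close>

lemma mat_adjoint_dim [simp]:
  "dim_row (mat_adjoint A) = dim_col A" "dim_col (mat_adjoint A) = dim_row A"
  by (simp_all add: mat_adjoint_def)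

lemma mat_adjoint_carrier [simp, intro]:
  "A \<in> carrier_mat m n \<Longrightarrow> mat_adjoint A \<in> carrier_mat n m"
  by (intro carrier_matI) (simp_all add: carrier_matD)

lemma mat_adjoint_index [simp]:
  fixes A :: "complex mat"
  shows "i < dim_col A \<Longrightarrow> j < dim_row A \<Longrightarrow> mat_adjoint A $$ (i, j) = cnj (A $$ (j, i))"
  by (simp add: mat_adjoint_def mat_of_rows_def)

lemma mat_adjoint_one [simp]: "mat_adjoint (1\<^sub>m n :: complex mat) = 1\<^sub>m n"
  by (rule eq_matI) auto

lemma mat_adjoint_adjoint [simp]: "mat_adjoint (mat_adjoint A) = (A :: complex mat)"
  by (rule eq_matI) auto

lemma mult_mat_index:
  "i < dim_row A \<Longrightarrow> j < dim_col B \<Longrightarrow>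
    (A * B) $$ (i, j) = (\<Sum>k<dim_row B. A $$ (i, k) * B $$ (k, j))" if "dim_col A = dim_row B"
  using that by (simp add: scalar_prod_def lessThan_atLeast0)

lemma mat_adjoint_mult:
  fixes A B :: "complex mat"
  assumes "A \<in> carrier_mat m n" "B \<in> carrier_mat n p"
  shows "mat_adjoint (A * B) = mat_adjoint B * mat_adjoint A"
proof (intro eq_matI)
  fix i j assume "i < dim_row (mat_adjoint B * mat_adjoint A)" "j < dim_col (mat_adjoint B * mat_adjoint A)"
  then have ij: "i < p" "j < m" using assms by auto
  then have "mat_adjoint (A * B) $$ (i, j) = (\<Sum>k<n. cnj (A $$ (j, k) * B $$ (k, i)))"
    using assms by (simp add: mult_mat_index del: index_mult_mat(1))
  also have "\<dots> = (mat_adjoint B * mat_adjoint A) $$ (i, j)"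
    using assms ij by (simp add: mult_mat_index mult.commute del: index_mult_mat(1))
  finally show "mat_adjoint (A * B) $$ (i, j) = (mat_adjoint B * mat_adjoint A) $$ (i, j)" .
qed (use assms in auto)

lemma divmod_index_less:
  fixes i p q :: nat
  assumes "i < p * q" shows "i div q < p" "i mod q < q"
proof -
  show "i div q < p" using assms by (simp add: less_mult_imp_div_less)
  from assms have "q > 0" by (cases q) auto
  then show "i mod q < q" by simp
qed

text \<open>A row or column index of a Kronecker product is a two-digit number with digits
  \<open>k div q\<close> and \<open>k mod q\<close>; summing over the digits separately is how all
  entry sums below split.\<close>

lemma sum_divmod:
  fixes F :: "nat \<Rightarrow> nat \<Rightarrow> 'a::comm_monoid_add"
  shows "(\<Sum>k<p * q. F (k div q) (k mod q)) = (\<Sum>i<p. \<Sum>j<q. F i j)"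
proof -
  have "(\<Sum>i<p. \<Sum>j<q. F i j) = (\<Sum>x\<in>{..<p} \<times> {..<q}. F (fst x) (snd x))"
    by (simp add: sum.cartesian_product case_prod_unfold)
  also have "\<dots> = (\<Sum>k<p * q. F (k div q) (k mod q))"
  proof (rule sum.reindex_bij_witness[where j = "\<lambda>(i, j). i * q + j" and i = "\<lambda>k. (k div q, k mod q)"])
    fix x assume x: "x \<in> {..<p} \<times> {..<q}"
    then obtain a b where ab: "x = (a, b)" "a < p" "b < q" by auto
    have "a * q + b < Suc a * q" using ab by simp
    also have "\<dots> \<le> p * q" using ab by (intro mult_right_mono) auto
    finally show "(case x of (i, j) \<Rightarrow> i * q + j) \<in> {..<p * q}" using ab by simp
  qed (auto dest: divmod_index_less)
  finally show ?thesis by simp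
qed

lemma sum_divmod_product:
  fixes f g :: "nat \<Rightarrow> 'a::semiring_0"
  shows "(\<Sum>k<p * q. f (k div q) * g (k mod q)) = (\<Sum>i<p. f i) * (\<Sum>j<q. g j)"
  using sum_divmod[of "\<lambda>i j. f i * g j" q p] by (simp add: sum_product)

lemma kron_dim [simp]:
  "dim_row (kron A B) = dim_row A * dim_row B" "dim_col (kron A B) = dim_col A * dim_col B"
  by (simp_all add: kron_def)

lemma kron_carrier [simp, intro]:
  "A \<in> carrier_mat m n \<Longrightarrow> B \<in> carrier_mat p q \<Longrightarrow> kron A B \<in> carrier_mat (m * p) (n * q)"
  by (auto simp: kron_def)

lemma kron_index:
  "i < dim_row A * dim_row B \<Longrightarrow> j < dim_col A * dim_col B \<Longrightarrow> kron A B $$ (i, j) =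
     A $$ (i div dim_row B, j div dim_col B) * B $$ (i mod dim_row B, j mod dim_col B)"
  by (simp add: kron_def)

lemma kron_mult:
  assumes A: "A \<in> carrier_mat m n" "C \<in> carrier_mat n p"
    and B: "B \<in> carrier_mat m' n'" "D \<in> carrier_mat n' p'"
  shows "kron A B * kron C D = kron (A * C) (B * D)"
proof (rule eq_matI)
  fix i j assume "i < dim_row (kron (A * C) (B * D))" "j < dim_col (kron (A * C) (B * D))"
  with A B have i: "i < m * m'" and j: "j < p * p'" by auto
  note di = divmod_index_less[OF i] and dj = divmod_index_less[OF j]
  have "(kron A B * kron C D) $$ (i, j) = (\<Sum>k<n * n'. kron A B $$ (i, k) * kron C D $$ (k, j))"
    using A B i j by (subst mult_mat_index) auto
  also have "\<dots> = (\<Sum>k<n * n'. (\<lambda>k. A $$ (i div m', k) * C $$ (k, j div p')) (k div n') *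
      (\<lambda>l. B $$ (i mod m', l) * D $$ (l, j mod p')) (k mod n'))"
    using A B i j by (intro sum.cong refl) (auto simp: kron_index)
  also have "\<dots> = (\<Sum>k<n. A $$ (i div m', k) * C $$ (k, j div p')) *
      (\<Sum>l<n'. B $$ (i mod m', l) * D $$ (l, j mod p'))"
    by (rule sum_divmod_product)
  also have "\<dots> = kron (A * C) (B * D) $$ (i, j)"
    using A B i j di dj by (simp add: kron_index mult_mat_index del: index_mult_mat(1))
  finally show "(kron A B * kron C D) $$ (i, j) = kron (A * C) (B * D) $$ (i, j)" .
qed (use A B in auto)

lemma kron_adjoint: "mat_adjoint (kron A B) = kron (mat_adjoint A) (mat_adjoint B)"
proof (intro eq_matI)
  fix i j assume "i < dim_row (kron (mat_adjoint A) (mat_adjoint B))" "j < dim_col (kron (mat_adjoint A) (mat_adjoint B))"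
  then have i: "i < dim_col A * dim_col B" and j: "j < dim_row A * dim_row B" by auto
  then show "mat_adjoint (kron A B) $$ (i, j) = kron (mat_adjoint A) (mat_adjoint B) $$ (i, j)"
    using divmod_index_less[OF i] divmod_index_less[OF j] by (simp add: kron_index)
qed auto

lemma kron_one [simp]: "kron (1\<^sub>m p) (1\<^sub>m q) = 1\<^sub>m (p * q)"
proof (intro eq_matI)
  fix i j assume "i < dim_row (1\<^sub>m (p * q) :: complex mat)" "j < dim_col (1\<^sub>m (p * q) :: complex mat)"
  then have ij: "i < p * q" "j < p * q" by auto
  note d = divmod_index_less[OF ij(1)] divmod_index_less[OF ij(2)]
  have "i = j \<longleftrightarrow> i div q = j div q \<and> i mod q = j mod q" by (metis div_mult_mod_eq)
  then show "kron (1\<^sub>m p) (1\<^sub>m q) $$ (i, j) = 1\<^sub>m (p * q) $$ (i, j)"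
    using ij d by (auto simp: kron_index)
qed auto

text \<open>The instance of associativity that composes the embeddings a \<mapsto> a \<otimes> 1 of
  successive stages.\<close>

lemma kron_kron_one: "kron (kron A (1\<^sub>m p)) (1\<^sub>m q) = kron A (1\<^sub>m (p * q))"
proof (intro eq_matI)
  fix i j
  assume "i < dim_row (kron A (1\<^sub>m (p * q)))" "j < dim_col (kron A (1\<^sub>m (p * q)))"
  then have i: "i < dim_row A * p * q" "i < dim_row A * (p * q)"
    and j: "j < dim_col A * p * q" "j < dim_col A * (p * q)" by (auto simp: mult.assoc)
  note d = divmod_index_less[OF i(1)] divmod_index_less[OF j(1)]
    divmod_index_less[OF divmod_index_less(1)[OF i(1)]] divmod_index_less[OF divmod_index_less(1)[OF j(1)]]
    divmod_index_less[OF i(2)] divmod_index_less[OF j(2)]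
  have div: "k div q div p = k div (p * q)" for k
    by (metis div_mult2_eq mult.commute)
  \<comment> \<open>Mixed radix: the last two digits of \<open>k\<close> are
    \<open>k div q mod p\<close> and \<open>k mod q\<close>, and together they determine
    \<open>k mod (p * q)\<close>.\<close>
  have mod: "k mod (p * q) = q * (k div q mod p) + k mod q" for k
    using mod_mult2_eq[of k q p] by (simp only: mult.commute)
  have eq: "i mod (p * q) = j mod (p * q) \<longleftrightarrow> i div q mod p = j div q mod p \<and> i mod q = j mod q"
  proof
    assume "i mod (p * q) = j mod (p * q)"
    then have "q * (i div q mod p) + i mod q = q * (j div q mod p) + j mod q"
      by (simp only: mod)
    moreover have "(q * a + r) div q = a" "(q * a + r) mod q = r" if "r < q" for a r
      using that by simp_all
    ultimately show "i div q mod p = j div q mod p \<and> i mod q = j mod q"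
      using d by metis
  qed (simp only: mod)
  have "kron (kron A (1\<^sub>m p)) (1\<^sub>m q) $$ (i, j) = A $$ (i div (p * q), j div (p * q)) *
      (if i div q mod p = j div q mod p then 1 else 0) * (if i mod q = j mod q then 1 else 0)"
    using i j d by (simp add: kron_index div)
  also have "\<dots> = A $$ (i div (p * q), j div (p * q)) * (if i mod (p * q) = j mod (p * q) then 1 else 0)"
    unfolding eq by simp
  also have "\<dots> = kron A (1\<^sub>m (p * q)) $$ (i, j)"
    using i j d by (simp add: kron_index)
  finally show "kron (kron A (1\<^sub>m p)) (1\<^sub>m q) $$ (i, j) = kron A (1\<^sub>m (p * q)) $$ (i, j)" .
qed (auto simp: mult.assoc)

lemma kron_minus_right:
  assumes "B \<in> carrier_mat m n" "C \<in> carrier_mat m n"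
  shows "kron A (B - C) = kron A B - kron A C"
proof (intro eq_matI)
  fix i j assume "i < dim_row (kron A B - kron A C)" "j < dim_col (kron A B - kron A C)"
  then have i: "i < dim_row A * m" and j: "j < dim_col A * n" using assms by auto
  then show "kron A (B - C) $$ (i, j) = (kron A B - kron A C) $$ (i, j)"
    using assms divmod_index_less[OF i] divmod_index_less[OF j]
    by (simp add: kron_index right_diff_distrib)
qed (use assms in auto)

section \<open>The Hilbert-Schmidt norm and the operator norm\<close>

text \<open>Squared and without normalisation, so that it is multiplicative under
  \<open>kron\<close>. Divided by the dimension it becomes the square of the trace seminorm on a
  finite stage.\<close>

definition hs_sq :: "complex mat \<Rightarrow> real" where
  "hs_sq A = (\<Sum>i<dim_row A. \<Sum>j<dim_col A. (cmod (A $$ (i, j)))\<^sup>2)"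

lemma hs_sq_nonneg: "hs_sq A \<ge> 0"
  by (simp add: hs_sq_def sum_nonneg)

text \<open>In this form the independence of different tensor factors for the trace enters the final
  estimate.\<close>

lemma hs_sq_kron: "hs_sq (kron A B) = hs_sq A * hs_sq B"
proof -
  let ?a = "\<lambda>i j. (cmod (A $$ (i, j)))\<^sup>2" and ?b = "\<lambda>i j. (cmod (B $$ (i, j)))\<^sup>2"
  have "hs_sq (kron A B) = (\<Sum>i<dim_row A * dim_row B. \<Sum>j<dim_col A * dim_col B.
      ?a (i div dim_row B) (j div dim_col B) * ?b (i mod dim_row B) (j mod dim_col B))"
    unfolding hs_sq_def
    by (auto simp: kron_index norm_mult power_mult_distrib intro!: sum.cong)
  also have "\<dots> = (\<Sum>i<dim_row A * dim_row B.
      (\<Sum>j<dim_col A. ?a (i div dim_row B) j) * (\<Sum>l<dim_col B. ?b (i mod dim_row B) l))"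
    by (intro sum.cong refl sum_divmod_product)
  also have "\<dots> = hs_sq A * hs_sq B"
    unfolding hs_sq_def
    by (rule sum_divmod_product[of "\<lambda>i. \<Sum>j<dim_col A. ?a i j" _ "\<lambda>k. \<Sum>l<dim_col B. ?b k l"])
  finally show ?thesis .
qed

definition mtrace :: "complex mat \<Rightarrow> complex" where
  "mtrace A = (\<Sum>i<dim_row A. A $$ (i, i))"

lemma mtrace_adjoint_mult:
  "mtrace (mat_adjoint A * A) = complex_of_real (hs_sq A)"
proof -
  have "mtrace (mat_adjoint A * A) = (\<Sum>i<dim_col A. \<Sum>k<dim_row A. cnj (A $$ (k, i)) * A $$ (k, i))"
    unfolding mtrace_def by (auto simp: mult_mat_index simp del: index_mult_mat(1) intro!: sum.cong)
  also have "\<dots> = (\<Sum>k<dim_row A. \<Sum>i<dim_col A. cnj (A $$ (k, i)) * A $$ (k, i))"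
    by (rule sum.swap)
  also have "\<dots> = complex_of_real (hs_sq A)"
    unfolding hs_sq_def of_real_sum
    by (intro sum.cong refl) (metis complex_norm_square mult.commute of_real_power)
  finally show ?thesis .
qed

lemma mtrace_mult_commute:
  assumes "A \<in> carrier_mat n n" "B \<in> carrier_mat n n"
  shows "mtrace (A * B) = mtrace (B * A)"
proof -
  have "mtrace (A * B) = (\<Sum>i<n. \<Sum>k<n. A $$ (i, k) * B $$ (k, i))"
    using assms unfolding mtrace_def by (auto simp: mult_mat_index simp del: index_mult_mat(1))
  also have "\<dots> = (\<Sum>k<n. \<Sum>i<n. B $$ (k, i) * A $$ (i, k))"
    by (subst sum.swap) (simp add: mult.commute)
  also have "\<dots> = mtrace (B * A)"
    using assms unfolding mtrace_def by (auto simp: mult_mat_index simp del: index_mult_mat(1))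
  finally show ?thesis .
qed

lemma mtrace_kron_one: "mtrace (kron A (1\<^sub>m q)) = of_nat q * mtrace A" if "A \<in> carrier_mat n n"
proof -
  have "mtrace (kron A (1\<^sub>m q)) = (\<Sum>i<n * q. A $$ (i div q, i div q) * 1)"
    using that unfolding mtrace_def
    by (intro sum.cong) (auto simp: kron_index dest: divmod_index_less)
  also have "\<dots> = mtrace A * of_nat q"
    using that sum_divmod_product[of "\<lambda>i. A $$ (i, i)" q "\<lambda>i. 1" n] by (simp add: mtrace_def)
  finally show ?thesis by simp
qed

section \<open>Euclidean norm and bounds by the operator norm\<close>

lemma vec_l2norm_sq: "(vec_l2norm v)\<^sup>2 = (\<Sum>i<dim_vec v. (cmod (v $ i))\<^sup>2)"
  and vec_l2norm_nonneg: "vec_l2norm v \<ge> 0"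
proof -
  have "scalar_prod v (conjugate v) = complex_of_real (\<Sum>i<dim_vec v. (cmod (v $ i))\<^sup>2)"
    by (simp add: scalar_prod_def lessThan_atLeast0 complex_norm_square del: of_real_power)
  then have *: "vec_l2norm v = sqrt (\<Sum>i<dim_vec v. (cmod (v $ i))\<^sup>2)"
    by (simp add: vec_l2norm_def)
  show "(vec_l2norm v)\<^sup>2 = (\<Sum>i<dim_vec v. (cmod (v $ i))\<^sup>2)" "vec_l2norm v \<ge> 0"
    unfolding * by (simp_all add: sum_nonneg)
qed

lemma vec_index_le_l2norm: "i < dim_vec v \<Longrightarrow> cmod (v $ i) \<le> vec_l2norm v"
proof -
  assume i: "i < dim_vec v"
  have "(cmod (v $ i))\<^sup>2 \<le> (vec_l2norm v)\<^sup>2"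
    unfolding vec_l2norm_sq using i by (intro member_le_sum) auto
  then show ?thesis using vec_l2norm_nonneg power2_le_imp_le by blast
qed

lemma vec_l2norm_smult: "vec_l2norm (c \<cdot>\<^sub>v v) = cmod c * vec_l2norm v"
proof -
  have "(vec_l2norm (c \<cdot>\<^sub>v v))\<^sup>2 = (cmod c * vec_l2norm v)\<^sup>2"
    by (simp add: power_mult_distrib vec_l2norm_sq norm_mult sum_distrib_left)
  then show ?thesis by (simp add: vec_l2norm_nonneg)
qed

text \<open>The supremum in \<open>mat_opnorm\<close> bounds its members only once the set is known
  to be bounded. A crude bound by absolute row sums is enough, as the coordinates of a vector in the
  unit ball have modulus at most 1.\<close>

lemma mat_opnorm_bdd:
  "bdd_above ((\<lambda>v. vec_l2norm (A *\<^sub>v v)) ` {v \<in> carrier_vec (dim_col A). vec_l2norm v \<le> 1})"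
proof (rule bdd_aboveI2)
  fix v assume "v \<in> {v \<in> carrier_vec (dim_col A). vec_l2norm v \<le> 1}"
  then have v: "dim_vec v = dim_col A" "vec_l2norm v \<le> 1" by auto
  have "(vec_l2norm (A *\<^sub>v v))\<^sup>2 \<le> (\<Sum>i<dim_row A. (\<Sum>j<dim_col A. cmod (A $$ (i, j)))\<^sup>2)"
    unfolding vec_l2norm_sq
  proof (simp, intro sum_mono power_mono)
    fix i assume "i \<in> {..<dim_row A}"
    then have "row A i \<bullet> v = (\<Sum>j<dim_col A. A $$ (i, j) * v $ j)"
      using v by (simp add: scalar_prod_def lessThan_atLeast0)
    also have "cmod \<dots> \<le> (\<Sum>j<dim_col A. cmod (A $$ (i, j)))"
    proof (rule sum_norm_le)
      fix j assume "j \<in> {..<dim_col A}"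
      then have "cmod (v $ j) \<le> 1" using vec_index_le_l2norm[of j v] v by simp
      then show "cmod (A $$ (i, j) * v $ j) \<le> cmod (A $$ (i, j))"
        by (simp add: norm_mult mult_left_le)
    qed
    finally show "cmod (row A i \<bullet> v) \<le> (\<Sum>j<dim_col A. cmod (A $$ (i, j)))" .
  qed auto
  then show "vec_l2norm (A *\<^sub>v v) \<le> sqrt (\<Sum>i<dim_row A. (\<Sum>j<dim_col A. cmod (A $$ (i, j)))\<^sup>2)"
    by (rule real_le_rsqrt)
qed

lemma mat_opnorm_bound:
  assumes v: "v \<in> carrier_vec (dim_col A)"
  shows "vec_l2norm (A *\<^sub>v v) \<le> mat_opnorm A * vec_l2norm v"
proof (cases "vec_l2norm v = 0")
  case True
  then have "v = 0\<^sub>v (dim_col A)"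
    using v vec_index_le_l2norm[of _ v] by (intro eq_vecI) force+
  then have "A *\<^sub>v v = 0\<^sub>v (dim_row A)" by (auto intro!: eq_vecI)
  then have "(vec_l2norm (A *\<^sub>v v))\<^sup>2 = 0" by (simp add: vec_l2norm_sq)
  then show ?thesis using True by simp
next
  case False
  then have pos: "vec_l2norm v > 0" using vec_l2norm_nonneg[of v] by linarith
  define c where "c = complex_of_real (inverse (vec_l2norm v))"
  have c: "cmod c = inverse (vec_l2norm v)" using pos by (simp add: c_def norm_inverse)
  have "vec_l2norm (A *\<^sub>v (c \<cdot>\<^sub>v v)) \<le> mat_opnorm A"
    unfolding mat_opnorm_def
    by (rule cSUP_upper[OF _ mat_opnorm_bdd]) (use v pos c in \<open>simp add: vec_l2norm_smult\<close>)
  moreover have "A *\<^sub>v (c \<cdot>\<^sub>v v) = c \<cdot>\<^sub>v (A *\<^sub>v v)"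
    using v by (intro mult_mat_vec[of A "dim_row A" "dim_col A"]) auto
  ultimately have "inverse (vec_l2norm v) * vec_l2norm (A *\<^sub>v v) \<le> mat_opnorm A"
    by (simp add: vec_l2norm_smult c)
  then show ?thesis using pos by (simp add: field_simps)
qed

text \<open>An entry is a coordinate of the image of a standard basis vector. This gives injectivity
  of the isometric embeddings and the norm bound for the normalised trace.\<close>

lemma mat_index_le_opnorm:
  assumes "i < dim_row A" "j < dim_col A"
  shows "cmod (A $$ (i, j)) \<le> mat_opnorm A"
proof -
  have u: "vec_l2norm (unit_vec (dim_col A) j :: complex vec) = 1"
  proof -
    have "(vec_l2norm (unit_vec (dim_col A) j :: complex vec))\<^sup>2 = (\<Sum>i<dim_col A. if i = j then 1 else 0)"
      unfolding vec_l2norm_sq using assms by (intro sum.cong) (auto simp: unit_vec_def)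
    also have "\<dots> = 1" using assms by simp
    finally show ?thesis using vec_l2norm_nonneg by (metis abs_of_nonneg abs_square_eq_1 real_sqrt_abs)
  qed
  have "cmod (A $$ (i, j)) = cmod ((A *\<^sub>v unit_vec (dim_col A) j) $ i)"
    using assms by simp
  also have "\<dots> \<le> vec_l2norm (A *\<^sub>v unit_vec (dim_col A) j)"
    using assms by (intro vec_index_le_l2norm) simp
  also have "\<dots> \<le> mat_opnorm A"
    using mat_opnorm_bound[of "unit_vec (dim_col A) j" A] u by simp
  finally show ?thesis .
qed

text \<open>\<open>hs_sq\<close> is the sum of the squared norms of the columns, and left
  multiplication acts on each column separately. On the GNS space this becomes the boundedness of
  left multiplication.\<close>

lemma hs_sq_mult_le:
  assumes A: "A \<in> carrier_mat m n" and X: "X \<in> carrier_mat n p"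
  shows "hs_sq (A * X) \<le> (mat_opnorm A)\<^sup>2 * hs_sq X"
proof -
  have hs: "hs_sq Y = (\<Sum>j<dim_col Y. (vec_l2norm (col Y j))\<^sup>2)" for Y
    unfolding hs_sq_def by (subst sum.swap) (simp add: vec_l2norm_sq)
  have "(vec_l2norm (col (A * X) j))\<^sup>2 \<le> (mat_opnorm A)\<^sup>2 * (vec_l2norm (col X j))\<^sup>2" if "j < p" for j
  proof -
    have "col (A * X) j = A *\<^sub>v col X j" using A X that by (intro eq_vecI) auto
    then have "vec_l2norm (col (A * X) j) \<le> mat_opnorm A * vec_l2norm (col X j)"
      using A X mat_opnorm_bound[of "col X j" A] by auto
    then show ?thesis
      by (metis power_mono power_mult_distrib vec_l2norm_nonneg)
  qed
  then show ?thesis using A X by (auto simp: hs sum_distrib_left intro!: sum_mono)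
qed

section \<open>C*-algebras and tracial states\<close>

text \<open>The C*-identity and submultiplicativity give \<open>norm y \<le> norm (star y)\<close>;
  since \<open>star\<close> is an involution, applying this to \<open>x\<close> and to
  \<open>star x\<close> gives equality.\<close>

lemma norm_star [simp]: "norm (star x) = norm (x :: 'a::cstar_algebra)"
proof -
  have le: "norm y \<le> norm (star y)" for y :: 'a
  proof (cases "norm y = 0")
    case False
    have "norm y * norm y \<le> norm (star y) * norm y"
      using cstar_identity[of y] norm_mult_ineq[of "star y" y] by (simp add: power2_eq_square)
    then show ?thesis using False by (simp add: mult_le_cancel_right)
  qed simp
  show ?thesis using le[of x] le[of "star x"] by (simp add: star_star)
qed

lemma star_scaleR: "star (r *\<^sub>R x) = r *\<^sub>R star (x :: 'a::cstar_algebra)"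
  by (metis complex_cnj_complex_of_real scaleC_of_real star_scaleC)

lemma bounded_linear_star: "bounded_linear (star :: 'a::cstar_algebra \<Rightarrow> 'a)"
  by (rule bounded_linear_intro[of _ 1]) (simp_all add: star_add star_scaleR)

lemmas tendsto_star = bounded_linear.tendsto[OF bounded_linear_star]

lemma star_diff: "star (x - y) = star x - star (y :: 'a::cstar_algebra)"
  by (rule linear_diff[OF bounded_linear.linear[OF bounded_linear_star]])

lemma star_one [simp]: "star 1 = (1 :: 'a::cstar_algebra)"
  using star_mult[of "star 1" "1 :: 'a"] by (simp add: star_star)

lemma scaleC_zero_left [simp]: "0 *\<^sub>C x = (0 :: 'a::cstar_algebra)"
  using scaleC_of_real[of 0 x] by simp

lemma bounded_linear_scaleC: "bounded_linear (\<lambda>x :: 'a::cstar_algebra. c *\<^sub>C x)"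
proof (rule bounded_linear_intro[of _ "cmod c"])
  show "c *\<^sub>C (r *\<^sub>R x) = r *\<^sub>R (c *\<^sub>C x)" for r and x :: 'a
    by (simp add: mult.commute scaleC_scaleC flip: scaleC_of_real)
qed (simp_all add: scaleC_add_right norm_scaleC mult.commute)

lemmas tendsto_scaleC = bounded_linear.tendsto[OF bounded_linear_scaleC]

lemma scaleC_diff_right: "c *\<^sub>C (x - y) = c *\<^sub>C x - c *\<^sub>C (y :: 'a::cstar_algebra)"
  by (rule linear_diff[OF bounded_linear.linear[OF bounded_linear_scaleC]])

definition unitary_elem :: "'a::cstar_algebra \<Rightarrow> bool" where
  "unitary_elem u \<longleftrightarrow> star u * u = 1 \<and> u * star u = 1"

lemma unitary_elem_star: "unitary_elem u \<Longrightarrow> unitary_elem (star u)"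
  by (simp add: unitary_elem_def star_star)

lemma norm_unitary: "unitary_elem u \<Longrightarrow> norm u = 1"
  using cstar_identity[of u] by (simp add: unitary_elem_def power2_eq_1_iff) (smt (verit) norm_ge_zero)

lemma norm_conjugate_unitary_le:
  assumes "unitary_elem u" shows "norm (u * x * star u) \<le> norm x"
proof -
  have "norm (u * x * star u) \<le> norm u * norm x * norm (star u)"
    by (meson norm_mult_ineq mult_right_mono norm_ge_zero order_trans)
  then show ?thesis using assms by (simp add: norm_unitary)
qed

section \<open>The seminorm of a tracial state\<close>

locale tracial =
  fixes \<tau> :: "'a::cstar_algebra \<Rightarrow> complex"
  assumes tracial_state: "tracial_state \<tau>"
begin

abbreviation sn :: "'a \<Rightarrow> real" where "sn \<equiv> gns_seminorm \<tau>"

lemma trace_add: "\<tau> (x + y) = \<tau> x + \<tau> y"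
  and trace_scaleC: "\<tau> (c *\<^sub>C x) = c * \<tau> x"
  and trace_le_norm: "cmod (\<tau> x) \<le> norm x"
  and trace_one: "\<tau> 1 = 1"
  and trace_positive: "\<tau> (star x * x) \<in> \<real>\<^sub>\<ge>\<^sub>0"
  and trace_commute: "\<tau> (x * y) = \<tau> (y * x)"
  using tracial_state by (auto simp: tracial_state_def)

lemma trace_scaleR: "\<tau> (r *\<^sub>R x) = r *\<^sub>R \<tau> x"
  by (metis trace_scaleC scaleC_of_real scaleR_conv_of_real)

lemma bounded_linear_trace: "bounded_linear \<tau>"
  by (rule bounded_linear_intro[of _ 1]) (simp_all add: trace_add trace_scaleR trace_le_norm)

lemmas trace_diff = linear_diff[OF bounded_linear.linear[OF bounded_linear_trace]]

lemma sn_nonneg: "sn x \<ge> 0"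
  and sn_sq: "(sn x)\<^sup>2 = Re (\<tau> (star x * x))"
proof -
  have "Re (\<tau> (star x * x)) \<ge> 0"
    using trace_positive[of x] by (auto simp: complex_nonneg_Reals_iff)
  then show "sn x \<ge> 0" "(sn x)\<^sup>2 = Re (\<tau> (star x * x))"
    by (simp_all add: gns_seminorm_def)
qed

lemma sn_le_norm: "sn x \<le> norm x"
proof (rule power2_le_imp_le)
  have "(sn x)\<^sup>2 \<le> cmod (\<tau> (star x * x))" unfolding sn_sq by (rule complex_Re_le_cmod)
  also have "\<dots> \<le> (norm x)\<^sup>2" using trace_le_norm[of "star x * x"] by (simp add: cstar_identity)
  finally show "(sn x)\<^sup>2 \<le> (norm x)\<^sup>2" .
qed simp

lemma sn_scaleC: "sn (c *\<^sub>C x) = cmod c * sn x"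
proof -
  have "\<tau> (star (c *\<^sub>C x) * (c *\<^sub>C x)) = (c * cnj c) * \<tau> (star x * x)"
    by (simp add: star_scaleC mult_scaleC_left mult_scaleC_right scaleC_scaleC trace_scaleC)
  also have "c * cnj c = complex_of_real ((cmod c)\<^sup>2)"
    by (simp only: complex_norm_square)
  finally have "\<tau> (star (c *\<^sub>C x) * (c *\<^sub>C x)) = complex_of_real ((cmod c)\<^sup>2) * \<tau> (star x * x)" .
  then have "(sn (c *\<^sub>C x))\<^sup>2 = (cmod c * sn x)\<^sup>2"
    by (simp only: sn_sq power_mult_distrib) simp
  then show ?thesis by (simp add: sn_nonneg)
qed

lemma sn_minus_commute: "sn (x - y) = sn (y - x)"
proof -
  have "(-1) *\<^sub>C (y - x) = x - y" using scaleC_of_real[of "-1" "y - x"] by simp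
  then show ?thesis using sn_scaleC[of "-1" "y - x"] by simp
qed

text \<open>The cross term \<open>B\<close> is bounded as in the Cauchy-Schwarz inequality, from
  positivity of the state on \<open>t *\<^sub>R x - s *\<^sub>R y\<close> for all real
  \<open>t\<close> and \<open>s\<close>.\<close>

lemma sn_triangle: "sn (x + y) \<le> sn x + sn y"
proof -
  define B where "B = Re (\<tau> (star x * y)) + Re (\<tau> (star y * x))"
  have quad: "t * s * B \<le> t\<^sup>2 * (sn x)\<^sup>2 + s\<^sup>2 * (sn y)\<^sup>2" for t s
  proof -
    let ?z = "t *\<^sub>R x - s *\<^sub>R y"
    have z: "star ?z * ?z = t\<^sup>2 *\<^sub>R (star x * x) + s\<^sup>2 *\<^sub>R (star y * y)
        - (t * s) *\<^sub>R (star x * y) - (t * s) *\<^sub>R (star y * x)"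
      by (simp add: star_diff star_scaleR algebra_simps power2_eq_square)
    have "(sn ?z)\<^sup>2 = t\<^sup>2 * (sn x)\<^sup>2 + s\<^sup>2 * (sn y)\<^sup>2 - t * s * B"
      unfolding sn_sq[of ?z] z unfolding sn_sq B_def by (simp add: trace_add trace_diff trace_scaleR algebra_simps)
    then show ?thesis by (smt (verit) zero_le_power2)
  qed
  \<comment> \<open>The best weights are \<open>t = sn y\<close> and \<open>s = sn x\<close>, but
    these may vanish. The shift by \<open>e\<close> makes them positive, hence cancellable, and is
    removed by letting \<open>e\<close> tend to 0.\<close>
  have "B \<le> 2 * (sn x + e) * (sn y + e)" if e: "e > 0" for e
  proof -
    let ?a = "sn x + e" and ?b = "sn y + e"
    have pos: "?a > 0" "?b > 0" using e sn_nonneg[of x] sn_nonneg[of y] by auto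
    have "?b * ?a * B \<le> ?b\<^sup>2 * (sn x)\<^sup>2 + ?a\<^sup>2 * (sn y)\<^sup>2" by (rule quad)
    also have "\<dots> \<le> ?b\<^sup>2 * ?a\<^sup>2 + ?a\<^sup>2 * ?b\<^sup>2"
      using e sn_nonneg[of x] sn_nonneg[of y] by (intro add_mono mult_left_mono power_mono) auto
    also have "\<dots> = (?b * ?a) * (2 * ?a * ?b)" by (simp add: power2_eq_square)
    finally show ?thesis using pos by (simp only: mult_le_cancel_left_pos mult_pos_pos)
  qed
  moreover have "((\<lambda>e. 2 * (sn x + e) * (sn y + e)) \<longlongrightarrow> 2 * (sn x + 0) * (sn y + 0)) (at_right 0)"
    by (intro tendsto_intros)
  ultimately have "B \<le> 2 * (sn x + 0) * (sn y + 0)"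
    by (intro tendsto_lowerbound[where F = "at_right (0::real)"])
      (auto simp: eventually_at_right_less eventually_at_right_field intro: exI[of _ 1])
  moreover have "(sn (x + y))\<^sup>2 = (sn x)\<^sup>2 + B + (sn y)\<^sup>2"
    unfolding sn_sq B_def by (simp add: star_add algebra_simps trace_add)
  ultimately have "(sn (x + y))\<^sup>2 \<le> (sn x + sn y)\<^sup>2" by (simp add: power2_sum)
  then show ?thesis using sn_nonneg by (meson add_nonneg_nonneg power2_le_imp_le)
qed

lemma sn_triangle_diff: "sn (x - z) \<le> sn (x - y) + sn (y - z)"
  using sn_triangle[of "x - y" "y - z"] by simp

lemma sn_zero [simp]: "sn 0 = 0"
  using sn_le_norm[of 0] sn_nonneg[of 0] by simp

text \<open>For left multiplication this holds in any state; for right multiplication it is the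
  trace property that moves \<open>b\<close> around to meet \<open>star b\<close>.\<close>

lemma sn_mult_unitary:
  assumes "unitary_elem b"
  shows "sn (b * x) = sn x" "sn (x * b) = sn x"
    and "\<tau> (star (b * x) * (b * y)) = \<tau> (star x * y)" "\<tau> (star (x * b) * (y * b)) = \<tau> (star x * y)"
proof -
  have b: "star b * b = 1" "b * star b = 1" using assms by (auto simp: unitary_elem_def)
  have "star (b * x) * (b * y) = star x * (star b * b) * y" for x y
    by (simp only: star_mult mult.assoc)
  then show l: "\<tau> (star (b * x) * (b * y)) = \<tau> (star x * y)" for x y by (simp add: b)
  have "\<tau> (star (x * b) * (y * b)) = \<tau> (b * star b * (star x * y))" for x y
    using trace_commute[of "star b * star x * y" b] by (simp add: star_mult mult.assoc)
  then show r: "\<tau> (star (x * b) * (y * b)) = \<tau> (star x * y)" for x y by (simp add: b)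
  show "sn (b * x) = sn x" "sn (x * b) = sn x" by (simp_all add: gns_seminorm_def l r)
qed

end

section \<open>The GNS representation\<close>

lemma gns_commutantD:
  "T \<in> gns_commutant \<tau> \<S> \<Longrightarrow> S \<in> \<S> \<Longrightarrow> gns_op_mult \<tau> T S = gns_op_mult \<tau> S T"
  by (simp add: gns_commutant_def)

lemma gns_commutantI:
  "T \<in> gns_bounded \<tau> \<Longrightarrow> (\<And>S. S \<in> \<S> \<Longrightarrow> gns_op_mult \<tau> T S = gns_op_mult \<tau> S T) \<Longrightarrow> T \<in> gns_commutant \<tau> \<S>"
  by (simp add: gns_commutant_def)

text \<open>For general C*-algebras the bound comes from the operator inequality x* a* a x \<le>
  |a|^2 x* x. Stated as a locale assumption, it can be supplied for UHF algebras by matrix estimates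
  and density.\<close>

locale bounded_tracial = tracial +
  assumes sn_mult_le: "gns_seminorm \<tau> (a * x) \<le> norm a * gns_seminorm \<tau> x"
begin

abbreviation gcls :: "(nat \<Rightarrow> 'a) \<Rightarrow> (nat \<Rightarrow> 'a) set" where "gcls X \<equiv> gns_rel \<tau> `` {X}"

lemma gns_CauchyD: "X \<in> gns_Cauchy \<tau> \<Longrightarrow> e > 0 \<Longrightarrow> \<exists>N. \<forall>m\<ge>N. \<forall>n\<ge>N. sn (X m - X n) < e"
  by (simp add: gns_Cauchy_def)

lemma gns_Cauchy_le:
  assumes X: "X \<in> gns_Cauchy \<tau>" and le: "\<And>m n. sn (Y m - Y n) \<le> K * sn (X m - X n)"
  shows "Y \<in> gns_Cauchy \<tau>"
  unfolding gns_Cauchy_def mem_Collect_eq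
proof (intro allI impI)
  fix e :: real assume e: "e > 0"
  \<comment> \<open>No sign of \<open>K\<close> is assumed; \<open>\<bar>K\<bar> + 1\<close> is a
    positive constant above it by which \<open>e\<close> can be divided.\<close>
  then obtain N where N: "\<And>m n. m \<ge> N \<Longrightarrow> n \<ge> N \<Longrightarrow> sn (X m - X n) < e / (\<bar>K\<bar> + 1)"
    using gns_CauchyD[OF X, of "e / (\<bar>K\<bar> + 1)"] by (auto simp: add_nonneg_pos)
  show "\<exists>N. \<forall>m\<ge>N. \<forall>n\<ge>N. sn (Y m - Y n) < e"
  proof (intro exI[of _ N] allI impI)
    fix m n assume "N \<le> m" "N \<le> n"
    have "sn (Y m - Y n) \<le> (\<bar>K\<bar> + 1) * sn (X m - X n)"
      by (rule order_trans[OF le]) (intro mult_right_mono sn_nonneg, simp)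
    also have "\<dots> < (\<bar>K\<bar> + 1) * (e / (\<bar>K\<bar> + 1))"
      using N[OF \<open>N \<le> m\<close> \<open>N \<le> n\<close>] by (intro mult_strict_left_mono) auto
    finally show "sn (Y m - Y n) < e" by (simp add: add_nonneg_pos nonzero_mult_div_cancel_left[OF less_imp_neq[symmetric]])
  qed
qed

lemma gns_Cauchy_add:
  assumes X: "X \<in> gns_Cauchy \<tau>" and Y: "Y \<in> gns_Cauchy \<tau>"
  shows "(\<lambda>n. X n + Y n) \<in> gns_Cauchy \<tau>"
  unfolding gns_Cauchy_def mem_Collect_eq
proof (intro allI impI)
  fix e :: real assume e: "e > 0"
  obtain N where N: "\<And>m n. m \<ge> N \<Longrightarrow> n \<ge> N \<Longrightarrow> sn (X m - X n) < e / 2"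
    using gns_CauchyD[OF X, of "e / 2"] e by auto
  obtain M where M: "\<And>m n. m \<ge> M \<Longrightarrow> n \<ge> M \<Longrightarrow> sn (Y m - Y n) < e / 2"
    using gns_CauchyD[OF Y, of "e / 2"] e by auto
  have "sn (X m + Y m - (X n + Y n)) < e" if "m \<ge> max M N" "n \<ge> max M N" for m n
    using sn_triangle[of "X m - X n" "Y m - Y n"] N[of m n] M[of m n] that
    by (simp add: algebra_simps)
  then show "\<exists>N. \<forall>m\<ge>N. \<forall>n\<ge>N. sn (X m + Y m - (X n + Y n)) < e" by blast
qed

lemma gns_Cauchy_const: "(\<lambda>_. x) \<in> gns_Cauchy \<tau>"
  by (simp add: gns_Cauchy_def)

lemma gns_relD: "(X, Y) \<in> gns_rel \<tau> \<Longrightarrow> X \<in> gns_Cauchy \<tau>"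
  "(X, Y) \<in> gns_rel \<tau> \<Longrightarrow> Y \<in> gns_Cauchy \<tau>"
  "(X, Y) \<in> gns_rel \<tau> \<Longrightarrow> (\<lambda>n. sn (X n - Y n)) \<longlonglongrightarrow> 0"
  by (auto simp: gns_rel_def)

lemma gns_relI_le:
  assumes XY: "(X, Y) \<in> gns_rel \<tau>" and "X' \<in> gns_Cauchy \<tau>" "Y' \<in> gns_Cauchy \<tau>"
    and le: "\<And>n. sn (X' n - Y' n) \<le> K * sn (X n - Y n)"
  shows "(X', Y') \<in> gns_rel \<tau>"
proof -
  have "(\<lambda>n. K * sn (X n - Y n)) \<longlonglongrightarrow> K * 0"
    by (intro tendsto_intros gns_relD(3)[OF XY])
  then have "(\<lambda>n. K * sn (X n - Y n)) \<longlonglongrightarrow> 0" by simp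
  then have "(\<lambda>n. sn (X' n - Y' n)) \<longlonglongrightarrow> 0"
    by (rule tendsto_sandwich[of "\<lambda>_. 0", rotated 3]) (simp_all add: sn_nonneg le)
  then show ?thesis using assms by (simp add: gns_rel_def)
qed

lemma equiv_gns_rel: "equiv (gns_Cauchy \<tau>) (gns_rel \<tau>)"
proof (rule equivI)
  show "trans (gns_rel \<tau>)"
  proof (rule transI)
    fix X Y Z assume XY: "(X, Y) \<in> gns_rel \<tau>" and YZ: "(Y, Z) \<in> gns_rel \<tau>"
    have "(\<lambda>n. sn (X n - Y n) + sn (Y n - Z n)) \<longlonglongrightarrow> 0 + 0"
      by (intro tendsto_intros gns_relD(3) XY YZ)
    then have "(\<lambda>n. sn (X n - Y n) + sn (Y n - Z n)) \<longlonglongrightarrow> 0" by simp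
    then have "(\<lambda>n. sn (X n - Z n)) \<longlonglongrightarrow> 0"
      by (rule tendsto_sandwich[of "\<lambda>_. 0", rotated 3])
        (simp_all add: sn_nonneg sn_triangle_diff)
    then show "(X, Z) \<in> gns_rel \<tau>"
      using gns_relD(1)[OF XY] gns_relD(2)[OF YZ] by (simp add: gns_rel_def)
  qed
  show "sym (gns_rel \<tau>)"
  proof (rule symI)
    fix X Y assume XY: "(X, Y) \<in> gns_rel \<tau>"
    have "(\<lambda>n. sn (Y n - X n)) = (\<lambda>n. sn (X n - Y n))" by (intro ext sn_minus_commute)
    then show "(Y, X) \<in> gns_rel \<tau>" using XY by (simp add: gns_rel_def)
  qed
  show "refl_on (gns_Cauchy \<tau>) (gns_rel \<tau>)"
    by (rule refl_onI) (simp add: gns_rel_def)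
  show "gns_rel \<tau> \<subseteq> gns_Cauchy \<tau> \<times> gns_Cauchy \<tau>"
    by (auto simp: gns_rel_def)
qed

lemma gcls_eqI: "(X, Y) \<in> gns_rel \<tau> \<Longrightarrow> gcls X = gcls Y"
  by (rule equiv_class_eq[OF equiv_gns_rel])

lemma gcls_eqD: "gcls X = gcls Y \<Longrightarrow> Y \<in> gns_Cauchy \<tau> \<Longrightarrow> (X, Y) \<in> gns_rel \<tau>"
  by (rule eq_equiv_class[OF _ equiv_gns_rel])

lemma gcls_in_space: "X \<in> gns_Cauchy \<tau> \<Longrightarrow> gcls X \<in> gns_space \<tau>"
  unfolding gns_space_def by (rule quotientI)

lemma gns_space_cases:
  assumes "\<xi> \<in> gns_space \<tau>"
  obtains X where "X \<in> gns_Cauchy \<tau>" "\<xi> = gcls X"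
  using assms unfolding gns_space_def by (rule quotientE)

lemma gcls_self: "X \<in> gns_Cauchy \<tau> \<Longrightarrow> X \<in> gcls X"
  by (rule equiv_class_self[OF equiv_gns_rel])

text \<open>The operations on GNS classes are unions over all representatives. Such a union
  collapses to a single class as soon as \<open>F\<close> respects the relation.\<close>

lemma UN_gcls:
  assumes X: "X \<in> gns_Cauchy \<tau>"
    and cong: "\<And>Y. (X, Y) \<in> gns_rel \<tau> \<Longrightarrow> (F X, F Y) \<in> gns_rel \<tau>"
  shows "(\<Union>Y\<in>gcls X. gcls (F Y)) = gcls (F X)"
proof -
  have "gcls (F Y) = gcls (F X)" if "Y \<in> gcls X" for Y
    using cong[of Y] that gcls_eqI[of "F X" "F Y"] by simp
  then show ?thesis using gcls_self[OF X] by blast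
qed

lemma gns_Cauchy_mult: "X \<in> gns_Cauchy \<tau> \<Longrightarrow> (\<lambda>n. a * X n) \<in> gns_Cauchy \<tau>"
  by (rule gns_Cauchy_le[where K = "norm a"]) (auto simp: sn_mult_le simp flip: right_diff_distrib)

lemma gns_Cauchy_scale: "X \<in> gns_Cauchy \<tau> \<Longrightarrow> (\<lambda>n. c *\<^sub>C X n) \<in> gns_Cauchy \<tau>"
  by (rule gns_Cauchy_le[where K = "cmod c"]) (auto simp: sn_scaleC simp flip: scaleC_diff_right)

lemma gns_rep_gcls:
  assumes X: "X \<in> gns_Cauchy \<tau>" shows "gns_rep \<tau> a (gcls X) = gcls (\<lambda>n. a * X n)"
proof -
  have "((\<lambda>n. a * X n), (\<lambda>n. a * Y n)) \<in> gns_rel \<tau>" if "(X, Y) \<in> gns_rel \<tau>" for Y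
    using gns_relD[OF that]
    by (intro gns_relI_le[OF that, where K = "norm a"] gns_Cauchy_mult)
      (auto simp: sn_mult_le simp flip: right_diff_distrib)
  then show ?thesis
    using UN_gcls[OF X, of "\<lambda>Y n. a * Y n"] gcls_in_space[OF X] by (simp add: gns_rep_def)
qed

lemma gns_scale_gcls:
  assumes X: "X \<in> gns_Cauchy \<tau>" shows "gns_scale \<tau> c (gcls X) = gcls (\<lambda>n. c *\<^sub>C X n)"
proof -
  have "((\<lambda>n. c *\<^sub>C X n), (\<lambda>n. c *\<^sub>C Y n)) \<in> gns_rel \<tau>" if "(X, Y) \<in> gns_rel \<tau>" for Y
    using gns_relD[OF that]
    by (intro gns_relI_le[OF that, where K = "cmod c"] gns_Cauchy_scale)
      (auto simp: sn_scaleC simp flip: scaleC_diff_right)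
  then show ?thesis
    using UN_gcls[OF X, of "\<lambda>Y n. c *\<^sub>C Y n"] by (simp add: gns_scale_def)
qed

lemma gns_add_gcls:
  assumes X: "X \<in> gns_Cauchy \<tau>" and Y: "Y \<in> gns_Cauchy \<tau>"
  shows "gns_add \<tau> (gcls X) (gcls Y) = gcls (\<lambda>n. X n + Y n)"
proof -
  have *: "((\<lambda>n. X n + Y n), (\<lambda>n. X' n + Y n)) \<in> gns_rel \<tau>"
    if "(X, X') \<in> gns_rel \<tau>" "Y \<in> gns_Cauchy \<tau>" for X X' Y
    using gns_relD[OF that(1)] that by (intro gns_relI_le[OF that(1), where K = 1] gns_Cauchy_add) auto
  have "(\<Union>Y'\<in>gcls Y. gcls (\<lambda>n. X' n + Y' n)) = gcls (\<lambda>n. X' n + Y n)"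
    if "X' \<in> gns_Cauchy \<tau>" for X'
    using UN_gcls[OF Y, of "\<lambda>Y n. X' n + Y n"] *[of Y _ X'] that by (simp add: add.commute)
  then have "gns_add \<tau> (gcls X) (gcls Y) = (\<Union>X'\<in>gcls X. gcls (\<lambda>n. X' n + Y n))"
    unfolding gns_add_def by (intro SUP_cong refl) (auto dest: gns_relD)
  also have "\<dots> = gcls (\<lambda>n. X n + Y n)"
    using UN_gcls[OF X, of "\<lambda>X n. X n + Y n"] *[of X _ Y] Y by simp
  finally show ?thesis .
qed

section \<open>Operators on the GNS space induced by multiplication with unitary elements\<close>

definition gns_isometry :: "('a \<Rightarrow> 'a) \<Rightarrow> bool" where
  "gns_isometry h \<longleftrightarrow> (\<forall>x y. h (x + y) = h x + h y) \<and> (\<forall>x y. h (x - y) = h x - h y) \<and>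
     (\<forall>c x. h (c *\<^sub>C x) = c *\<^sub>C h x) \<and> (\<forall>x y. \<tau> (star (h x) * h y) = \<tau> (star x * y))"

text \<open>The image of a class under \<open>h\<close>, which is a full class again when
  \<open>h\<close> has an isometric inverse. In this form the limits defining the inner product of
  two images are literally those for the original classes, so norms are preserved without evaluating
  any limit.\<close>

definition gns_lift :: "('a \<Rightarrow> 'a) \<Rightarrow> 'a gns_op" where
  "gns_lift h = restrict (\<lambda>\<xi>. (\<lambda>X n. h (X n)) ` \<xi>) (gns_space \<tau>)"

lemma gns_isometry_sn: "gns_isometry h \<Longrightarrow> sn (h x) = sn x"
  by (simp add: gns_isometry_def gns_seminorm_def)

lemma gns_isometry_Cauchy:
  assumes "gns_isometry h" "X \<in> gns_Cauchy \<tau>" shows "(\<lambda>n. h (X n)) \<in> gns_Cauchy \<tau>"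
proof (rule gns_Cauchy_le[OF assms(2), where K = 1])
  fix m n
  have "h (X m) - h (X n) = h (X m - X n)" using assms(1) by (simp add: gns_isometry_def)
  then show "sn (h (X m) - h (X n)) \<le> 1 * sn (X m - X n)"
    using gns_isometry_sn[OF assms(1)] by simp
qed

lemma gns_isometry_rel:
  assumes h: "gns_isometry h" and XY: "(X, Y) \<in> gns_rel \<tau>"
  shows "((\<lambda>n. h (X n)), (\<lambda>n. h (Y n))) \<in> gns_rel \<tau>"
proof (rule gns_relI_le[OF XY, where K = 1])
  fix n
  have "h (X n) - h (Y n) = h (X n - Y n)" using h by (simp add: gns_isometry_def)
  then show "sn (h (X n) - h (Y n)) \<le> 1 * sn (X n - Y n)"
    using gns_isometry_sn[OF h] by simp
qed (use gns_relD[OF XY] gns_isometry_Cauchy[OF h] in auto)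

context
  fixes h h' assumes h: "gns_isometry h" and h': "gns_isometry h'"
    and inv: "\<And>x. h (h' x) = x" "\<And>x. h' (h x) = x"
begin

lemma gns_lift_gcls:
  assumes X: "X \<in> gns_Cauchy \<tau>" shows "gns_lift h (gcls X) = gcls (\<lambda>n. h (X n))"
proof -
  have "(\<lambda>X n. h (X n)) ` gcls X = gcls (\<lambda>n. h (X n))"
  proof
    show "(\<lambda>X n. h (X n)) ` gcls X \<subseteq> gcls (\<lambda>n. h (X n))"
      using gns_isometry_rel[OF h] by auto
    show "gcls (\<lambda>n. h (X n)) \<subseteq> (\<lambda>X n. h (X n)) ` gcls X"
    proof
      fix Z assume "Z \<in> gcls (\<lambda>n. h (X n))"
      then have "((\<lambda>n. h' (h (X n))), (\<lambda>n. h' (Z n))) \<in> gns_rel \<tau>"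
        using gns_isometry_rel[OF h', of "\<lambda>n. h (X n)" Z] by simp
      then have "(\<lambda>n. h' (Z n)) \<in> gcls X" by (simp add: inv)
      then show "Z \<in> (\<lambda>X n. h (X n)) ` gcls X"
        by (intro image_eqI[of Z "\<lambda>X n. h (X n)" "\<lambda>n. h' (Z n)"]) (simp_all add: inv)
    qed
  qed
  then show ?thesis using gcls_in_space[OF X] by (simp add: gns_lift_def)
qed

lemma gns_lift_bounded: "gns_lift h \<in> gns_bounded \<tau>"
proof -
  have hadd: "h (x + y) = h x + h y" and hsc: "h (c *\<^sub>C x) = c *\<^sub>C h x"
    and hin: "\<tau> (star (h x) * h y) = \<tau> (star x * y)" for x y c
    using h by (auto simp: gns_isometry_def)
  have 1: "gns_lift h \<in> gns_space \<tau> \<rightarrow>\<^sub>E gns_space \<tau>"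
  proof (rule PiE_I)
    fix \<xi> assume "\<xi> \<in> gns_space \<tau>"
    then show "gns_lift h \<xi> \<in> gns_space \<tau>"
      by (elim gns_space_cases) (simp add: gns_lift_gcls gcls_in_space gns_isometry_Cauchy[OF h])
  qed (simp add: gns_lift_def)
  have 2: "gns_lift h (gns_add \<tau> \<xi> \<eta>) = gns_add \<tau> (gns_lift h \<xi>) (gns_lift h \<eta>)"
    if "\<xi> \<in> gns_space \<tau>" "\<eta> \<in> gns_space \<tau>" for \<xi> \<eta>
    using that by (elim gns_space_cases)
      (simp add: gns_lift_gcls gns_add_gcls gns_Cauchy_add gns_isometry_Cauchy[OF h] hadd)
  have 3: "gns_lift h (gns_scale \<tau> c \<xi>) = gns_scale \<tau> c (gns_lift h \<xi>)"
    if "\<xi> \<in> gns_space \<tau>" for c \<xi>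
    using that by (elim gns_space_cases)
      (simp add: gns_lift_gcls gns_scale_gcls gns_Cauchy_scale gns_isometry_Cauchy[OF h] hsc)
  have 4: "gns_norm \<tau> (gns_lift h \<xi>) \<le> 1 * gns_norm \<tau> \<xi>" if "\<xi> \<in> gns_space \<tau>" for \<xi>
  proof -
    let ?H = "\<lambda>X n. h (X n)"
    have "(\<lambda>(X, Y). lim (\<lambda>n. \<tau> (star (X n) * Y n))) ` (?H ` \<xi> \<times> ?H ` \<xi>) =
        (\<lambda>(X, Y). lim (\<lambda>n. \<tau> (star (?H X n) * ?H Y n))) ` (\<xi> \<times> \<xi>)"
      by (force simp: image_iff)
    then have "gns_inner \<tau> (?H ` \<xi>) (?H ` \<xi>) = gns_inner \<tau> \<xi> \<xi>"
      unfolding gns_inner_def by (simp add: hin)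
    then show ?thesis using that by (simp add: gns_norm_def gns_lift_def)
  qed
  show ?thesis unfolding gns_bounded_def
    by (intro CollectI conjI ballI allI exI[of _ 1] 1 2 3 4)
qed

end

lemma gns_isometry_mult:
  assumes b: "unitary_elem b"
  shows "gns_isometry (\<lambda>x. b * x)" "gns_isometry (\<lambda>x. x * b)"
  using sn_mult_unitary[OF b]
  by (simp_all add: gns_isometry_def distrib_left distrib_right left_diff_distrib right_diff_distrib
      mult_scaleC_left mult_scaleC_right)

lemma unitary_elem_cancel:
  fixes b :: 'a
  assumes "unitary_elem b"
  shows "b * (star b * x) = x" "star b * (b * x) = x" "x * b * star b = x" "x * star b * b = x"
proof -
  have b: "star b * b = 1" "b * star b = 1" using assms by (auto simp: unitary_elem_def)
  show "x * b * star b = x" "x * star b * b = x" by (simp_all add: b mult.assoc)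
  have "(b * star b) * x = x" "(star b * b) * x = x" by (simp_all add: b)
  then show "b * (star b * x) = x" "star b * (b * x) = x" by (simp_all only: mult.assoc)
qed

lemma gns_right_mult_gcls:
  assumes "unitary_elem b" "X \<in> gns_Cauchy \<tau>"
  shows "gns_lift (\<lambda>x. x * b) (gcls X) = gcls (\<lambda>n. X n * b)"
  using assms by (intro gns_lift_gcls[where h' = "\<lambda>x. x * star b"])
    (auto intro: gns_isometry_mult unitary_elem_star simp: unitary_elem_cancel)

lemma gns_rep_unitary:
  assumes "unitary_elem b" shows "gns_rep \<tau> b = gns_lift (\<lambda>x. b * x)"
proof (rule extensionalityI[of _ "gns_space \<tau>"])
  fix \<xi> assume "\<xi> \<in> gns_space \<tau>"
  then obtain X where X: "X \<in> gns_Cauchy \<tau>" "\<xi> = gcls X" by (rule gns_space_cases)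
  have "gns_lift (\<lambda>x. b * x) (gcls X) = gcls (\<lambda>n. b * X n)"
    using assms X by (intro gns_lift_gcls[where h' = "\<lambda>x. star b * x"])
      (auto intro: gns_isometry_mult unitary_elem_star simp: unitary_elem_cancel)
  then show "gns_rep \<tau> b \<xi> = gns_lift (\<lambda>x. b * x) \<xi>" using X by (simp add: gns_rep_gcls)
qed (simp_all add: gns_rep_def gns_lift_def)

text \<open>The implementing relation will be tested on unitary elements only, and for these the
  representation is the lift of an isometry.\<close>

lemma gns_rep_bounded:
  assumes "unitary_elem b" shows "gns_rep \<tau> b \<in> gns_bounded \<tau>"
  unfolding gns_rep_unitary[OF assms]
  by (rule gns_lift_bounded[where h' = "\<lambda>x. star b * x"])
    (use assms in \<open>auto intro: gns_isometry_mult unitary_elem_star simp: unitary_elem_cancel\<close>)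

text \<open>Associativity, (a x) b = a (x b), read on representing sequences. It forces every
  operator of the von Neumann algebra to commute with right multiplications by unitary
  elements.\<close>

lemma gns_right_mult_commutant:
  assumes b: "unitary_elem b"
  shows "gns_lift (\<lambda>x. x * b) \<in> gns_commutant \<tau> (range (gns_rep \<tau>))"
proof -
  have bounded: "gns_lift (\<lambda>x. x * b) \<in> gns_bounded \<tau>"
    by (rule gns_lift_bounded[where h' = "\<lambda>x. x * star b"])
      (use b in \<open>auto intro: gns_isometry_mult unitary_elem_star simp: unitary_elem_cancel\<close>)
  have comm: "gns_op_mult \<tau> (gns_lift (\<lambda>x. x * b)) (gns_rep \<tau> a) =
      gns_op_mult \<tau> (gns_rep \<tau> a) (gns_lift (\<lambda>x. x * b))" for a
  proof (rule extensionalityI[of _ "gns_space \<tau>"])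
    fix \<xi> assume \<xi>: "\<xi> \<in> gns_space \<tau>"
    then obtain X where X: "X \<in> gns_Cauchy \<tau>" "\<xi> = gcls X" by (rule gns_space_cases)
    have "(\<lambda>n. X n * b) \<in> gns_Cauchy \<tau>"
      by (rule gns_isometry_Cauchy[OF gns_isometry_mult(2)[OF b] X(1)])
    then show "gns_op_mult \<tau> (gns_lift (\<lambda>x. x * b)) (gns_rep \<tau> a) \<xi> =
        gns_op_mult \<tau> (gns_rep \<tau> a) (gns_lift (\<lambda>x. x * b)) \<xi>"
      using \<xi> X b by (simp add: compose_def gns_rep_gcls gns_right_mult_gcls gns_Cauchy_mult mult.assoc)
  qed (simp_all add: compose_def)
  show ?thesis
    by (rule gns_commutantI[OF bounded]) (elim rangeE, simp only: comm)
qed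

text \<open>A bounded member of a set of operators always lies in the double commutant of that
  set.\<close>

lemma gns_rep_in_vN: "unitary_elem b \<Longrightarrow> gns_rep \<tau> b \<in> gns_vN \<tau>"
  unfolding gns_vN_def
  by (rule gns_commutantI[OF gns_rep_bounded], assumption)
    (rule gns_commutantD[OF _ rangeI, symmetric], assumption)

text \<open>The vector implementing a weakly inner automorphism \<open>f = Ad u\<close> is \<open>u 1\<close>: since \<open>u\<close> commutes with
  right multiplications, \<open>u 1 b = u b 1 = f b (u 1)\<close>.\<close>

lemma weakly_inner_vector:
  assumes "weakly_inner \<tau> f"
  obtains X where "X \<in> gns_Cauchy \<tau>" "\<not> (\<lambda>n. sn (X n)) \<longlonglongrightarrow> 0"
    "\<And>b. unitary_elem b \<Longrightarrow> (\<lambda>n. sn (X n * b - f b * X n)) \<longlonglongrightarrow> 0"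
proof -
  from assms obtain \<psi> u v where \<psi>: "vN_extension \<tau> f \<psi>" and u: "u \<in> gns_vN \<tau>"
    and adj: "is_gns_adjoint \<tau> u v" and vu: "gns_op_mult \<tau> v u = gns_op_id \<tau>"
    and Ad: "\<And>T. T \<in> gns_vN \<tau> \<Longrightarrow> \<psi> T = gns_op_mult \<tau> u (gns_op_mult \<tau> T v)"
    unfolding weakly_inner_def by blast
  have ub: "u \<in> gns_bounded \<tau>" and vb: "v \<in> gns_bounded \<tau>"
    using adj by (auto simp: is_gns_adjoint_def)
  \<comment> \<open>The trace vector, on which left and right multiplication by \<open>b\<close>
    agree: both give the class of \<open>b\<close>.\<close>
  define \<xi> where "\<xi> = gcls (\<lambda>_. 1)"
  have \<xi>: "\<xi> \<in> gns_space \<tau>" unfolding \<xi>_def by (intro gcls_in_space gns_Cauchy_const)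
  have w: "u \<xi> \<in> gns_space \<tau>" using ub \<xi> by (auto simp: gns_bounded_def)
  then obtain X where X: "X \<in> gns_Cauchy \<tau>" "u \<xi> = gcls X" by (rule gns_space_cases)
  have vw: "v (u \<xi>) = \<xi>"
    using fun_cong[OF vu, of \<xi>] \<xi> by (simp add: compose_def gns_op_id_def)
  show ?thesis
  proof (rule that[OF X(1)])
    show "\<not> (\<lambda>n. sn (X n)) \<longlonglongrightarrow> 0"
    proof
      assume "(\<lambda>n. sn (X n)) \<longlonglongrightarrow> 0"
      \<comment> \<open>The zero vector is written as a multiple by 0, because homogeneity of
        \<open>v\<close> with respect to \<open>gns_scale\<close> is part of being bounded. Applying
        \<open>v\<close> then carries the vanishing of \<open>u \<xi>\<close> back to
        \<open>\<xi>\<close>, which has norm 1.\<close>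
      then have "(X, (\<lambda>n. 0 *\<^sub>C X n)) \<in> gns_rel \<tau>"
        using X gns_Cauchy_const by (simp add: gns_rel_def)
      then have "gcls (\<lambda>n. 0 *\<^sub>C X n) = gcls X" by (rule gcls_eqI[symmetric])
      then have "gns_scale \<tau> 0 (u \<xi>) = u \<xi>"
        unfolding X(2) gns_scale_gcls[OF X(1)] .
      moreover have "v (gns_scale \<tau> 0 (u \<xi>)) = gns_scale \<tau> 0 (v (u \<xi>))"
        using vb w by (simp add: gns_bounded_def)
      ultimately have "\<xi> = gns_scale \<tau> 0 \<xi>" by (simp only: vw)
      then have "gcls (\<lambda>_. 1) = gcls (\<lambda>_. 0)"
        unfolding \<xi>_def by (simp add: gns_scale_gcls gns_Cauchy_const)
      then have "(\<lambda>n. sn (1 - 0)) \<longlonglongrightarrow> 0"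
        using gcls_eqD[of "\<lambda>_. 1" "\<lambda>_. 0"] gns_Cauchy_const gns_relD(3) by blast
      moreover have "sn 1 = 1" by (simp add: gns_seminorm_def trace_one)
      ultimately show False by (simp add: LIMSEQ_const_iff)
    qed
    fix b :: 'a assume b: "unitary_elem b"
    let ?R = "gns_lift (\<lambda>x. x * b)"
    have "gns_op_mult \<tau> u ?R = gns_op_mult \<tau> ?R u"
      using u gns_right_mult_commutant[OF b] unfolding gns_vN_def by (rule gns_commutantD)
    then have "gns_op_mult \<tau> u ?R \<xi> = gns_op_mult \<tau> ?R u \<xi>" by simp
    then have "u (?R \<xi>) = ?R (u \<xi>)" using \<xi> by (simp add: compose_def)
    then have 1: "u (gcls (\<lambda>_. b)) = gcls (\<lambda>n. X n * b)"
      using b X by (simp add: \<xi>_def gns_right_mult_gcls gns_Cauchy_const)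
    have "gns_rep \<tau> (f b) = \<psi> (gns_rep \<tau> b)"
      using \<psi> by (simp add: vN_extension_def)
    also have "\<dots> = gns_op_mult \<tau> u (gns_op_mult \<tau> (gns_rep \<tau> b) v)"
      by (intro Ad gns_rep_in_vN b)
    finally have "gns_rep \<tau> (f b) (u \<xi>) = u (gns_rep \<tau> b \<xi>)"
      using w vw by (simp add: compose_def)
    then have 2: "gcls (\<lambda>n. f b * X n) = u (gcls (\<lambda>_. b))"
      using X by (simp add: \<xi>_def gns_rep_gcls gns_Cauchy_const)
    have "gcls (\<lambda>n. X n * b) = gcls (\<lambda>n. f b * X n)" by (simp only: 1 2)
    then have "((\<lambda>n. X n * b), (\<lambda>n. f b * X n)) \<in> gns_rel \<tau>"
      by (rule gcls_eqD) (rule gns_Cauchy_mult[OF X(1)])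
    then show "(\<lambda>n. sn (X n * b - f b * X n)) \<longlonglongrightarrow> 0" by (rule gns_relD)
  qed
qed

end

section \<open>The trace of an infinite tensor product\<close>

definition mat_unit :: "nat \<Rightarrow> nat \<times> nat \<Rightarrow> complex mat" where
  "mat_unit N p = Matrix.mat N N (\<lambda>q. if q = p then 1 else 0)"

lemma mat_unit_carrier [simp, intro]: "mat_unit N p \<in> carrier_mat N N"
  by (simp add: mat_unit_def)

lemma mat_unit_mult:
  assumes "j < N"
  shows "mat_unit N (i, j) * mat_unit N (k, l) = (if j = k then mat_unit N (i, l) else 0\<^sub>m N N)"
proof (rule eq_matI)
  fix r s assume "r < dim_row (if j = k then mat_unit N (i, l) else 0\<^sub>m N N)"
    "s < dim_col (if j = k then mat_unit N (i, l) else 0\<^sub>m N N)"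
  then have rs: "r < N" "s < N" by (auto simp: mat_unit_def split: if_splits)
  then have "(mat_unit N (i, j) * mat_unit N (k, l)) $$ (r, s) =
      (\<Sum>m<N. mat_unit N (i, j) $$ (r, m) * mat_unit N (k, l) $$ (m, s))"
    by (subst mult_mat_index) (auto simp: mat_unit_def)
  also have "\<dots> = (\<Sum>m<N. if m = j then (if r = i \<and> j = k \<and> s = l then 1 else 0) else 0)"
    using rs by (intro sum.cong) (auto simp: mat_unit_def)
  also have "\<dots> = (if j = k then mat_unit N (i, l) else 0\<^sub>m N N) $$ (r, s)"
    using rs assms by (auto simp: mat_unit_def)
  finally show "(mat_unit N (i, j) * mat_unit N (k, l)) $$ (r, s) =
      (if j = k then mat_unit N (i, l) else 0\<^sub>m N N) $$ (r, s)" .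
qed (auto simp: mat_unit_def)

lemma linear_functional_mat_units:
  fixes \<sigma> :: "complex mat \<Rightarrow> complex"
  assumes add: "\<And>a b. a \<in> carrier_mat N N \<Longrightarrow> b \<in> carrier_mat N N \<Longrightarrow> \<sigma> (a + b) = \<sigma> a + \<sigma> b"
    and smult: "\<And>c a. a \<in> carrier_mat N N \<Longrightarrow> \<sigma> (c \<cdot>\<^sub>m a) = c * \<sigma> a"
    and a: "a \<in> carrier_mat N N"
  shows "\<sigma> a = (\<Sum>p\<in>{..<N} \<times> {..<N}. a $$ p * \<sigma> (mat_unit N p))"
proof -
  \<comment> \<open>Matrices of all sizes share one type and \<open>\<sigma>\<close> is linear only
    on the square ones of size \<open>N\<close>, so \<open>a\<close> is assembled by inserting one
    entry at a time.\<close>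
  define P where "P S = Matrix.mat N N (\<lambda>p. if p \<in> S then a $$ p else 0)" for S
  have P: "\<sigma> (P S) = (\<Sum>p\<in>S. a $$ p * \<sigma> (mat_unit N p))" if "finite S" "S \<subseteq> {..<N} \<times> {..<N}" for S
    using that
  proof (induction S rule: finite_induct)
    case empty
    have "P {} = 0 \<cdot>\<^sub>m 1\<^sub>m N" by (rule eq_matI) (auto simp: P_def)
    then show ?case using smult[of "1\<^sub>m N" 0] by simp
  next
    case (insert p S)
    have "P (insert p S) = P S + a $$ p \<cdot>\<^sub>m mat_unit N p"
      using insert by (intro eq_matI) (auto simp: P_def mat_unit_def)
    then have "\<sigma> (P (insert p S)) = \<sigma> (P S) + a $$ p * \<sigma> (mat_unit N p)"
      by (simp add: add smult P_def)
    then show ?case using insert by simp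
  qed
  have "P ({..<N} \<times> {..<N}) = a" using a by (intro eq_matI) (auto simp: P_def)
  then show ?thesis using P[of "{..<N} \<times> {..<N}"] by simp
qed

text \<open>Matrix units decide everything. For i \<noteq> j, e_ij = e_ij e_jj while e_jj e_ij = 0,
  so \<open>\<sigma>\<close> vanishes off the diagonal; e_ii = e_i0 e_0i and e_00 = e_0i e_i0 make
  it constant on the diagonal, and the value at the identity fixes the constant.\<close>

lemma mat_trace_unique:
  fixes \<sigma> :: "complex mat \<Rightarrow> complex"
  assumes add: "\<And>a b. a \<in> carrier_mat N N \<Longrightarrow> b \<in> carrier_mat N N \<Longrightarrow> \<sigma> (a + b) = \<sigma> a + \<sigma> b"
    and smult: "\<And>c a. a \<in> carrier_mat N N \<Longrightarrow> \<sigma> (c \<cdot>\<^sub>m a) = c * \<sigma> a"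
    and commute: "\<And>a b. a \<in> carrier_mat N N \<Longrightarrow> b \<in> carrier_mat N N \<Longrightarrow> \<sigma> (a * b) = \<sigma> (b * a)"
    and one: "\<sigma> (1\<^sub>m N) = 1" and N: "N > 0" and a: "a \<in> carrier_mat N N"
  shows "\<sigma> a = mtrace a / of_nat N"
proof -
  define s where "s = \<sigma> (mat_unit N (0, 0))"
  have zero: "\<sigma> (0\<^sub>m N N) = 0" using add[of "0\<^sub>m N N" "0\<^sub>m N N"] by simp
  have unit: "\<sigma> (mat_unit N (i, j)) = (if i = j then s else 0)" if "i < N" "j < N" for i j
  proof (cases "i = j")
    case True
    then show ?thesis
      using commute[of "mat_unit N (i, 0)" "mat_unit N (0, i)"] N that by (simp add: mat_unit_mult s_def)
  next
    case False
    then show ?thesis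
      using commute[of "mat_unit N (i, j)" "mat_unit N (j, j)"] that by (simp add: mat_unit_mult zero)
  qed
  have gen: "\<sigma> b = mtrace b * s" if b: "b \<in> carrier_mat N N" for b
  proof -
    have "\<sigma> b = (\<Sum>p\<in>{..<N} \<times> {..<N}. b $$ p * \<sigma> (mat_unit N p))"
      by (rule linear_functional_mat_units[of N \<sigma>]) (use add smult b in auto)
    also have "\<dots> = (\<Sum>i<N. \<Sum>j<N. b $$ (i, j) * \<sigma> (mat_unit N (i, j)))"
      by (simp add: sum.cartesian_product case_prod_unfold)
    also have "\<dots> = (\<Sum>i<N. \<Sum>j<N. if i = j then b $$ (i, i) * s else 0)"
      by (intro sum.cong refl) (simp add: unit)
    also have "\<dots> = mtrace b * s" using b by (simp add: mtrace_def sum_distrib_right)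
    finally show ?thesis .
  qed
  have "of_nat N * s = 1" using gen[of "1\<^sub>m N"] one by (simp add: mtrace_def)
  then have "s = 1 / of_nat N" using N by (simp add: field_simps)
  then show ?thesis using gen[OF a] by simp
qed

lemma (in tracial) continuous_on_sn: "continuous_on S f \<Longrightarrow> continuous_on S (\<lambda>x. sn (f x))"
  unfolding gns_seminorm_def
  by (intro continuous_on_real_sqrt continuous_on_Re continuous_on_mult
      bounded_linear.continuous_on[OF bounded_linear_trace]
      bounded_linear.continuous_on[OF bounded_linear_star])

section \<open>The finite stages of an infinite tensor product\<close>

locale tensor_identification =
  fixes n :: "nat \<Rightarrow> nat" and \<iota> :: "nat \<Rightarrow> complex mat \<Rightarrow> 'a::cstar_algebra"
  assumes n_pos: "n l \<ge> 1" and identification: "inf_tensor_identification n \<iota>"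
begin

definition N :: "nat \<Rightarrow> nat" where "N k = (\<Prod>l<k. n l)"
abbreviation M :: "nat \<Rightarrow> complex mat set" where "M k \<equiv> carrier_mat (N k) (N k)"
definition D :: "'a set" where "D = (\<Union>k. \<iota> k ` M k)"
text \<open>Plays two roles: the size of the identity by which stage \<open>k\<close> is embedded
  into stage \<open>j\<close>, and later the dimension of a block of consecutive factors.\<close>

definition blk :: "nat \<Rightarrow> nat \<Rightarrow> nat" where "blk k j = (\<Prod>l\<in>{k..<j}. n l)"

lemma N_pos: "N k > 0"
  unfolding N_def using n_pos by (intro prod_pos) (auto simp: Suc_le_eq)

lemma N_Suc: "N (Suc k) = N k * n k" by (simp add: N_def)

lemma blk_Suc: "k \<le> j \<Longrightarrow> blk k (Suc j) = blk k j * n j"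
  by (simp add: blk_def)

lemma blk_self [simp]: "blk k k = 1" by (simp add: blk_def)

lemma N_blk: "k \<le> j \<Longrightarrow> N j = N k * blk k j"
  by (induction j rule: dec_induct) (simp_all add: N_Suc blk_Suc)

lemma blk_pos: "blk k j > 0"
  unfolding blk_def using n_pos by (intro prod_pos) (auto simp: Suc_le_eq)

lemma embedding: "matrix_embedding (N k) (\<iota> k)"
  using identification by (simp add: inf_tensor_identification_def N_def)

lemma \<iota>_add: "a \<in> M k \<Longrightarrow> b \<in> M k \<Longrightarrow> \<iota> k (a + b) = \<iota> k a + \<iota> k b"
  and \<iota>_mult: "a \<in> M k \<Longrightarrow> b \<in> M k \<Longrightarrow> \<iota> k (a * b) = \<iota> k a * \<iota> k b"
  and \<iota>_smult: "a \<in> M k \<Longrightarrow> \<iota> k (c \<cdot>\<^sub>m a) = c *\<^sub>C \<iota> k a"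
  and \<iota>_adjoint: "a \<in> M k \<Longrightarrow> \<iota> k (mat_adjoint a) = star (\<iota> k a)"
  and \<iota>_norm: "a \<in> M k \<Longrightarrow> norm (\<iota> k a) = mat_opnorm a"
  and \<iota>_one: "\<iota> k (1\<^sub>m (N k)) = 1"
  using embedding[of k] by (simp_all add: matrix_embedding_def)

lemma \<iota>_diff: assumes "a \<in> M k" "b \<in> M k" shows "\<iota> k (a - b) = \<iota> k a - \<iota> k b"
proof -
  have "(a - b) + b = a" using assms by (intro eq_matI) auto
  then show ?thesis using \<iota>_add[of "a - b" k b] assms by (simp add: algebra_simps minus_carrier_mat)
qed

lemma \<iota>_Suc: "a \<in> M k \<Longrightarrow> \<iota> (Suc k) (kron a (1\<^sub>m (n k))) = \<iota> k a"
  using identification by (simp add: inf_tensor_identification_def N_def)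

lemma kron_blk_carrier: "k \<le> j \<Longrightarrow> a \<in> M k \<Longrightarrow> b \<in> carrier_mat (blk k j) (blk k j) \<Longrightarrow> kron a b \<in> M j"
  unfolding N_blk[of k j] by (rule kron_carrier)

lemma \<iota>_lift:
  assumes "k \<le> j" "a \<in> M k" shows "\<iota> j (kron a (1\<^sub>m (blk k j))) = \<iota> k a"
  using assms(1)
proof (induction j rule: dec_induct)
  case base
  have "kron a (1\<^sub>m 1) = a" using assms by (intro eq_matI) (auto simp: kron_index)
  then show ?case by simp
next
  case (step j)
  have "\<iota> (Suc j) (kron (kron a (1\<^sub>m (blk k j))) (1\<^sub>m (n j))) = \<iota> j (kron a (1\<^sub>m (blk k j)))"
    using step assms(2) by (intro \<iota>_Suc kron_blk_carrier) auto
  then show ?case using step by (simp add: kron_kron_one blk_Suc)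
qed

lemma D_I: "a \<in> M k \<Longrightarrow> \<iota> k a \<in> D" by (auto simp: D_def)

lemma D_cases: assumes "x \<in> D" obtains k a where "a \<in> M k" "x = \<iota> k a"
  using assms by (auto simp: D_def)

lemma D_lift: assumes "a \<in> M k" "k \<le> j" obtains b where "b \<in> M j" "\<iota> k a = \<iota> j b"
proof (rule that)
  show "kron a (1\<^sub>m (blk k j)) \<in> M j" using assms by (simp add: kron_blk_carrier)
  show "\<iota> k a = \<iota> j (kron a (1\<^sub>m (blk k j)))" using assms by (simp add: \<iota>_lift)
qed

lemma D_cases2:
  assumes "x \<in> D" "y \<in> D" obtains k a b where "a \<in> M k" "b \<in> M k" "x = \<iota> k a" "y = \<iota> k b"
proof -
  obtain k a where x: "a \<in> M k" "x = \<iota> k a" using assms(1) by (rule D_cases)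
  obtain j b where y: "b \<in> M j" "y = \<iota> j b" using assms(2) by (rule D_cases)
  obtain a' where a': "a' \<in> M (max k j)" "\<iota> k a = \<iota> (max k j) a'"
    by (rule D_lift[OF x(1) max.cobounded1])
  obtain b' where b': "b' \<in> M (max k j)" "\<iota> j b = \<iota> (max k j) b'"
    by (rule D_lift[OF y(1) max.cobounded2])
  show ?thesis
    by (rule that[OF a'(1) b'(1)]) (simp_all only: x(2) y(2) a'(2) b'(2))
qed

lemma closure_D: "closure D = UNIV"
  using identification by (simp add: inf_tensor_identification_def D_def N_def)

text \<open>Reduces closed conditions on the algebra to matrices. With two variables, both elements
  can be moved to a common finite stage.\<close>

lemma dense_closed: "closed S \<Longrightarrow> (\<And>x. x \<in> D \<Longrightarrow> x \<in> S) \<Longrightarrow> x \<in> S"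
  using closure_minimal[of D S] closure_D by blast

lemma dense_closed2:
  assumes "closed S" "\<And>x y. x \<in> D \<Longrightarrow> y \<in> D \<Longrightarrow> (x, y) \<in> S" shows "(x, y) \<in> S"
proof -
  have "D \<times> D \<subseteq> S" using assms(2) by auto
  then have "closure (D \<times> D) \<subseteq> S" using assms(1) by (rule closure_minimal)
  then show ?thesis by (auto simp: closure_Times closure_D)
qed

lemma \<iota>_inj: assumes "a \<in> M k" "b \<in> M k" "\<iota> k a = \<iota> k b" shows "a = b"
proof (rule eq_matI)
  fix i j assume ij: "i < dim_row b" "j < dim_col b"
  have "mat_opnorm (a - b) = 0" using assms \<iota>_diff[of a k b] \<iota>_norm[of "a - b" k] by (simp add: minus_carrier_mat)
  then have "cmod ((a - b) $$ (i, j)) \<le> 0" using mat_index_le_opnorm[of i "a - b" j] ij assms by simp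
  then show "a $$ (i, j) = b $$ (i, j)" using ij assms by simp
qed (use assms in auto)

section \<open>Existence and uniqueness of the tracial state\<close>

lemma mtrace_le_norm: assumes "a \<in> M k" shows "cmod (mtrace a / of_nat (N k)) \<le> norm (\<iota> k a)"
proof -
  have "mtrace a = (\<Sum>i<N k. a $$ (i, i))" using assms by (simp add: mtrace_def)
  also have "cmod \<dots> \<le> (\<Sum>i<N k. mat_opnorm a)"
    by (rule sum_norm_le) (use assms in \<open>simp add: mat_index_le_opnorm\<close>)
  finally show ?thesis using assms N_pos[of k] by (simp add: \<iota>_norm norm_divide field_simps)
qed

text \<open>By injectivity the matrix of the later stage is the earlier one tensored with an
  identity, and the size of that identity cancels in the normalised trace.\<close>

lemma mtrace_compat:
  assumes "a \<in> M k" "b \<in> M j" "\<iota> k a = \<iota> j b"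
  shows "mtrace a / of_nat (N k) = mtrace b / of_nat (N j)"
proof -
  have *: "mtrace a / of_nat (N k) = mtrace b / of_nat (N j)"
    if "k \<le> j" "a \<in> M k" "b \<in> M j" "\<iota> k a = \<iota> j b" for k j a b
  proof -
    have "b = kron a (1\<^sub>m (blk k j))"
      using that by (intro \<iota>_inj[of _ j]) (simp_all add: kron_blk_carrier \<iota>_lift)
    then have "mtrace b = of_nat (blk k j) * mtrace a" using mtrace_kron_one[OF that(2)] by simp
    then show ?thesis using N_blk[OF that(1)] blk_pos[of k j] by simp
  qed
  show ?thesis
    using *[of k j a b] *[of j k b a] assms by (cases "k \<le> j") auto
qed

text \<open>The normalised traces agree on common elements, hence define a function on the dense
  union of the stages. It is 1-Lipschitz there and so extends to the closure.\<close>

lemma exists_trace: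
  obtains \<tau> where "continuous_on UNIV \<tau>" "\<And>k a. a \<in> M k \<Longrightarrow> \<tau> (\<iota> k a) = mtrace a / of_nat (N k)"
proof -
  define t where "t x = (THE c. \<exists>k a. a \<in> M k \<and> x = \<iota> k a \<and> c = mtrace a / of_nat (N k))" for x
  have t: "t (\<iota> k a) = mtrace a / of_nat (N k)" if "a \<in> M k" for k a
    unfolding t_def
  proof (rule the_equality)
    show "\<exists>k' a'. a' \<in> M k' \<and> \<iota> k a = \<iota> k' a' \<and> mtrace a / of_nat (N k) = mtrace a' / of_nat (N k')"
      using that by blast
  qed (metis mtrace_compat that)
  have le: "dist (t x) (t y) \<le> dist x y" if "x \<in> D" "y \<in> D" for x y
  proof -
    from that obtain k a b where ab: "a \<in> M k" "b \<in> M k" "x = \<iota> k a" "y = \<iota> k b" by (rule D_cases2)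
    have "mtrace (a - b) = mtrace a - mtrace b" using ab by (auto simp: mtrace_def sum_subtractf)
    then have "t x - t y = mtrace (a - b) / of_nat (N k)" using ab t by (simp add: diff_divide_distrib)
    then show ?thesis
      using mtrace_le_norm[of "a - b" k] ab by (simp add: dist_norm \<iota>_diff minus_carrier_mat)
  qed
  have uc: "uniformly_continuous_on D t"
    unfolding uniformly_continuous_on_def using le by (meson le_less_trans)
  obtain \<tau> where \<tau>: "uniformly_continuous_on (closure D) \<tau>" "\<And>x. x \<in> D \<Longrightarrow> t x = \<tau> x"
  proof (rule uniformly_continuous_on_extension_on_closure[OF uc])
    fix g assume "uniformly_continuous_on (closure D) g" "\<And>x. x \<in> D \<Longrightarrow> t x = g x"
    then show thesis by (rule that)
  qed
  show ?thesis
  proof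
    show "continuous_on UNIV \<tau>" using \<tau>(1) by (simp add: closure_D uniformly_continuous_imp_continuous)
    show "\<tau> (\<iota> k a) = mtrace a / of_nat (N k)" if "a \<in> M k" for k a
      using \<tau>(2)[OF D_I[OF that]] t[OF that] by simp
  qed
qed

lemma tracial_state_extension:
  assumes cont: "continuous_on UNIV \<tau>"
    and \<tau>: "\<And>k a. a \<in> M k \<Longrightarrow> \<tau> (\<iota> k a) = mtrace a / of_nat (N k)"
  shows "tracial_state \<tau>"
proof -
  note cont_intros = continuous_on_compose2[OF cont _ subset_UNIV] continuous_intros
    bounded_linear.continuous_on[OF bounded_linear_star]
    bounded_linear.continuous_on[OF bounded_linear_scaleC]
  have add: "\<tau> (x + y) = \<tau> x + \<tau> y" for x y
  proof -
    have "(x, y) \<in> {p. \<tau> (fst p + snd p) = \<tau> (fst p) + \<tau> (snd p)}"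
    proof (rule dense_closed2)
      show "closed {p. \<tau> (fst p + snd p) = \<tau> (fst p) + \<tau> (snd p)}"
        by (intro closed_Collect_eq cont_intros)
      fix x y assume "x \<in> D" "y \<in> D"
      then obtain k a b where ab: "a \<in> M k" "b \<in> M k" "x = \<iota> k a" "y = \<iota> k b" by (rule D_cases2)
      then have "mtrace (a + b) = mtrace a + mtrace b" by (auto simp: mtrace_def sum.distrib)
      then have "\<tau> (\<iota> k (a + b)) = \<tau> x + \<tau> y" using ab by (simp add: \<tau> add_divide_distrib)
      then show "(x, y) \<in> {p. \<tau> (fst p + snd p) = \<tau> (fst p) + \<tau> (snd p)}"
        using ab by (simp add: \<iota>_add)
    qed
    then show ?thesis by simp
  qed
  have commute: "\<tau> (x * y) = \<tau> (y * x)" for x y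
  proof -
    have "(x, y) \<in> {p. \<tau> (fst p * snd p) = \<tau> (snd p * fst p)}"
    proof (rule dense_closed2)
      show "closed {p. \<tau> (fst p * snd p) = \<tau> (snd p * fst p)}"
        by (intro closed_Collect_eq cont_intros)
      fix x y assume "x \<in> D" "y \<in> D"
      then obtain k a b where ab: "a \<in> M k" "b \<in> M k" "x = \<iota> k a" "y = \<iota> k b" by (rule D_cases2)
      then have "\<tau> (\<iota> k (a * b)) = \<tau> (\<iota> k (b * a))"
        using mtrace_mult_commute[OF ab(1,2)] by (simp add: \<tau>)
      then show "(x, y) \<in> {p. \<tau> (fst p * snd p) = \<tau> (snd p * fst p)}"
        using ab by (simp add: \<iota>_mult)
    qed
    then show ?thesis by simp
  qed
  have scale: "\<tau> (c *\<^sub>C x) = c * \<tau> x" for c x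
  proof -
    have "x \<in> {x. \<tau> (c *\<^sub>C x) = c * \<tau> x}"
    proof (rule dense_closed)
      show "closed {x. \<tau> (c *\<^sub>C x) = c * \<tau> x}" by (intro closed_Collect_eq cont_intros)
      fix x assume "x \<in> D"
      then obtain k a where a: "a \<in> M k" "x = \<iota> k a" by (rule D_cases)
      then have "mtrace (c \<cdot>\<^sub>m a) = c * mtrace a" by (auto simp: mtrace_def sum_distrib_left)
      then have "\<tau> (\<iota> k (c \<cdot>\<^sub>m a)) = c * \<tau> x" using a by (simp add: \<tau>)
      then show "x \<in> {x. \<tau> (c *\<^sub>C x) = c * \<tau> x}" using a by (simp add: \<iota>_smult)
    qed
    then show ?thesis by simp
  qed
  have le: "cmod (\<tau> x) \<le> norm x" for x
  proof -
    have "x \<in> {x. cmod (\<tau> x) \<le> norm x}"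
    proof (rule dense_closed)
      show "closed {x. cmod (\<tau> x) \<le> norm x}" by (intro closed_Collect_le cont_intros)
      fix x assume "x \<in> D"
      then show "x \<in> {x. cmod (\<tau> x) \<le> norm x}"
        by (elim D_cases) (simp add: \<tau> mtrace_le_norm)
    qed
    then show ?thesis by simp
  qed
  have pos: "\<tau> (star x * x) \<in> \<real>\<^sub>\<ge>\<^sub>0" for x
  proof -
    have "x \<in> {x. \<tau> (star x * x) \<in> \<real>\<^sub>\<ge>\<^sub>0}"
    proof (rule dense_closed)
      have "continuous_on UNIV (\<lambda>x. \<tau> (star x * x))" by (intro cont_intros)
      then show "closed {x. \<tau> (star x * x) \<in> \<real>\<^sub>\<ge>\<^sub>0}"
        using continuous_closed_vimage[OF closed_nonneg_Reals_complex, of "\<lambda>x. \<tau> (star x * x)"]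
        by (simp add: vimage_def continuous_on_eq_continuous_at)
      fix x assume "x \<in> D"
      then obtain k a where a: "a \<in> M k" "x = \<iota> k a" by (rule D_cases)
      then have "star x * x = \<iota> k (mat_adjoint a * a)" by (simp add: \<iota>_adjoint \<iota>_mult)
      then have "\<tau> (star x * x) = \<tau> (\<iota> k (mat_adjoint a * a))" by simp
      also have "\<dots> = mtrace (mat_adjoint a * a) / of_nat (N k)"
        by (intro \<tau> mult_carrier_mat[of _ "N k" "N k"] mat_adjoint_carrier a(1))
      finally have "\<tau> (star x * x) = complex_of_real (hs_sq a / real (N k))"
        by (simp add: mtrace_adjoint_mult)
      then show "x \<in> {x. \<tau> (star x * x) \<in> \<real>\<^sub>\<ge>\<^sub>0}"
        by (simp only: mem_Collect_eq nonneg_Reals_of_real_iff) (simp add: hs_sq_nonneg)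
    qed
    then show ?thesis by simp
  qed
  have "\<tau> 1 = 1" using \<tau>[of "1\<^sub>m (N 0)" 0] N_pos[of 0] by (simp add: \<iota>_one mtrace_def)
  then show ?thesis
    unfolding tracial_state_def by (intro conjI allI add commute scale le pos)
qed

text \<open>Restricted to a stage, a tracial state is a normalised tracial functional on a matrix
  algebra, and there is only one.\<close>

lemma tracial_state_stage:
  assumes "tracial_state \<sigma>" "a \<in> M k" shows "\<sigma> (\<iota> k a) = mtrace a / of_nat (N k)"
proof -
  interpret tracial \<sigma> by unfold_locales (rule assms(1))
  show ?thesis
    using mat_trace_unique[where \<sigma> = "\<lambda>a. \<sigma> (\<iota> k a)" and N = "N k", OF _ _ _ _ N_pos assms(2)]
    by (simp add: \<iota>_add \<iota>_smult \<iota>_mult \<iota>_one trace_add trace_scaleC trace_one trace_commute)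
qed

text \<open>\<open>the_trace\<close> is a definite description, so its properties become available
  only through existence and uniqueness. Uniqueness holds on the stages, and continuity spreads it
  to the whole algebra.\<close>

lemma tracial_state_the_trace: "tracial_state (the_trace :: 'a \<Rightarrow> complex)"
proof -
  obtain \<tau> where \<tau>: "continuous_on UNIV \<tau>" "\<And>k a. a \<in> M k \<Longrightarrow> \<tau> (\<iota> k a) = mtrace a / of_nat (N k)"
    using exists_trace by blast
  have "(the_trace :: 'a \<Rightarrow> complex) = \<tau>"
    unfolding the_trace_def
  proof (rule the_equality)
    show "tracial_state \<tau>" using \<tau> by (rule tracial_state_extension)
    fix \<sigma> :: "'a \<Rightarrow> complex" assume \<sigma>: "tracial_state \<sigma>"
    interpret tracial \<sigma> by unfold_locales (rule \<sigma>)
    show "\<sigma> = \<tau>"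
    proof
      fix x
      have "x \<in> {x. \<sigma> x = \<tau> x}"
      proof (rule dense_closed)
        show "closed {x. \<sigma> x = \<tau> x}"
          by (intro closed_Collect_eq \<tau>(1) bounded_linear.continuous_on[OF bounded_linear_trace] continuous_intros)
        fix x assume "x \<in> D"
        then obtain k a where "a \<in> M k" "x = \<iota> k a" by (rule D_cases)
        then show "x \<in> {x. \<sigma> x = \<tau> x}" using \<tau>(2) tracial_state_stage[OF \<sigma>] by simp
      qed
      then show "\<sigma> x = \<tau> x" by simp
    qed
  qed
  then show ?thesis using tracial_state_extension[OF \<tau>] by simp
qed

sublocale tracial "the_trace :: 'a \<Rightarrow> complex"
  by unfold_locales (rule tracial_state_the_trace)

lemma sn_stage: assumes "a \<in> M k" shows "(sn (\<iota> k a))\<^sup>2 = hs_sq a / real (N k)"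
proof -
  have "star (\<iota> k a) * \<iota> k a = \<iota> k (mat_adjoint a * a)"
    by (simp only: \<iota>_adjoint[OF assms] \<iota>_mult[OF mat_adjoint_carrier[OF assms] assms])
  then have "the_trace (star (\<iota> k a) * \<iota> k a) = mtrace (mat_adjoint a * a) / of_nat (N k)"
    by (simp only: tracial_state_stage[OF tracial_state_the_trace
          mult_carrier_mat[OF mat_adjoint_carrier[OF assms] assms]])
  then have "the_trace (star (\<iota> k a) * \<iota> k a) = complex_of_real (hs_sq a / real (N k))"
    by (simp add: mtrace_adjoint_mult)
  then show ?thesis by (simp only: sn_sq Re_complex_of_real)
qed

sublocale bounded_tracial "the_trace :: 'a \<Rightarrow> complex"
proof
  fix x y :: 'a
  \<comment> \<open>Both sides are continuous in \<open>(x, y)\<close>, so the inequality may be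
    checked in a common stage. There the embedding is isometric and \<open>hs_sq_mult_le\<close>
    applies.\<close>
  have "(x, y) \<in> {p. sn (fst p * snd p) \<le> norm (fst p) * sn (snd p)}"
  proof (rule dense_closed2)
    show "closed {p. sn (fst p * snd p) \<le> norm (fst p) * sn (snd p)}"
      by (intro closed_Collect_le continuous_on_sn continuous_intros)
    fix x y assume "x \<in> D" "y \<in> D"
    then obtain k a b where ab: "a \<in> M k" "b \<in> M k" "x = \<iota> k a" "y = \<iota> k b" by (rule D_cases2)
    have "(sn (x * y))\<^sup>2 = (sn (\<iota> k (a * b)))\<^sup>2"
      by (simp only: ab(3,4) \<iota>_mult[OF ab(1,2)])
    also have "\<dots> = hs_sq (a * b) / real (N k)"
      by (intro sn_stage mult_carrier_mat[OF ab(1,2)])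
    also have "\<dots> \<le> (mat_opnorm a)\<^sup>2 * hs_sq b / real (N k)"
      by (rule divide_right_mono[OF hs_sq_mult_le[OF ab(1,2)]]) simp
    also have "\<dots> = (norm x * sn y)\<^sup>2"
      by (simp only: ab(3,4) power_mult_distrib sn_stage[OF ab(2)] \<iota>_norm[OF ab(1)] times_divide_eq_right)
    finally have "sn (x * y) \<le> norm x * sn y"
      by (rule power2_le_imp_le) (intro mult_nonneg_nonneg norm_ge_zero sn_nonneg)
    then show "(x, y) \<in> {p. sn (fst p * snd p) \<le> norm (fst p) * sn (snd p)}" by simp
  qed
  then show "sn (x * y) \<le> norm x * sn y" by simp
qed

end

section \<open>Unitary matrices\<close>

lemma unitary_groupI:
  "U \<in> carrier_mat n n \<Longrightarrow> mat_adjoint U * U = 1\<^sub>m n \<Longrightarrow> U * mat_adjoint U = 1\<^sub>m n \<Longrightarrow>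
    U \<in> carrier (unitary_group n)"
  by (simp add: unitary_group_def)

lemma unitary_groupD:
  assumes "U \<in> carrier (unitary_group n)"
  shows "U \<in> carrier_mat n n" "mat_adjoint U * U = 1\<^sub>m n" "U * mat_adjoint U = 1\<^sub>m n"
  using assms by (simp_all add: unitary_group_def)

lemma unitary_one: "1\<^sub>m n \<in> carrier (unitary_group n)"
  by (rule unitary_groupI) simp_all

lemma unitary_adjoint: "U \<in> carrier (unitary_group n) \<Longrightarrow> mat_adjoint U \<in> carrier (unitary_group n)"
  by (rule unitary_groupI) (simp_all add: unitary_groupD mat_adjoint_carrier[of _ n n])

lemma unitary_mult:
  assumes U: "U \<in> carrier (unitary_group n)" and V: "V \<in> carrier (unitary_group n)"
  shows "U * V \<in> carrier (unitary_group n)"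
proof -
  note u = unitary_groupD[OF U] and v = unitary_groupD[OF V]
  note ua = mat_adjoint_carrier[OF u(1)] and va = mat_adjoint_carrier[OF v(1)]
  have adj: "mat_adjoint (U * V) = mat_adjoint V * mat_adjoint U"
    by (rule mat_adjoint_mult[OF u(1) v(1)])
  show ?thesis
  proof (rule unitary_groupI)
    have "mat_adjoint V * mat_adjoint U * (U * V) = mat_adjoint V * (mat_adjoint U * U * V)"
      by (simp only: assoc_mult_mat[OF va ua mult_carrier_mat[OF u(1) v(1)]] assoc_mult_mat[OF ua u(1) v(1)])
    then show "mat_adjoint (U * V) * (U * V) = 1\<^sub>m n" using v by (simp add: adj u(2))
    have "U * V * (mat_adjoint V * mat_adjoint U) = U * (V * mat_adjoint V * mat_adjoint U)"
      by (simp only: assoc_mult_mat[OF u(1) v(1) mult_carrier_mat[OF va ua]] assoc_mult_mat[OF v(1) va ua])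
    then show "U * V * mat_adjoint (U * V) = 1\<^sub>m n" using u ua by (simp add: adj v(3))
  qed (rule mult_carrier_mat[OF u(1) v(1)])
qed

lemma unitary_kron:
  assumes U: "U \<in> carrier (unitary_group p)" and V: "V \<in> carrier (unitary_group q)"
  shows "kron U V \<in> carrier (unitary_group (p * q))"
proof -
  note u = unitary_groupD[OF U] and v = unitary_groupD[OF V]
  note ua = mat_adjoint_carrier[OF u(1)] and va = mat_adjoint_carrier[OF v(1)]
  show ?thesis
  proof (rule unitary_groupI)
    show "mat_adjoint (kron U V) * kron U V = 1\<^sub>m (p * q)"
      unfolding kron_adjoint kron_mult[OF ua u(1) va v(1)] by (simp add: u v)
    show "kron U V * mat_adjoint (kron U V) = 1\<^sub>m (p * q)"
      unfolding kron_adjoint kron_mult[OF u(1) ua v(1) va] by (simp add: u v)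
  qed (rule kron_carrier[OF u(1) v(1)])
qed

lemma unitary_conj_one:
  assumes "U \<in> carrier (unitary_group n)" shows "U * 1\<^sub>m n * mat_adjoint U = 1\<^sub>m n"
  using unitary_groupD[OF assms] by simp

lemma kron_conj:
  assumes "U \<in> carrier_mat p p" "A \<in> carrier_mat p p" "V \<in> carrier_mat q q" "B \<in> carrier_mat q q"
  shows "kron U V * kron A B * mat_adjoint (kron U V) = kron (U * A * mat_adjoint U) (V * B * mat_adjoint V)"
  unfolding kron_adjoint kron_mult[OF assms]
  by (rule kron_mult[OF mult_carrier_mat[OF assms(1,2)] mat_adjoint_carrier[OF assms(1)]
        mult_carrier_mat[OF assms(3,4)] mat_adjoint_carrier[OF assms(3)]])

section \<open>Amplified representations\<close>

definition dsum_one :: "complex mat \<Rightarrow> nat \<Rightarrow> complex mat" where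
  "dsum_one A r = four_block_mat A (0\<^sub>m (dim_row A) r) (0\<^sub>m r (dim_col A)) (1\<^sub>m r)"

lemma dsum_one_carrier: "A \<in> carrier_mat p p \<Longrightarrow> dsum_one A r \<in> carrier_mat (p + r) (p + r)"
  unfolding dsum_one_def by (rule four_block_carrier_mat) auto

lemma dsum_one_mult:
  assumes "A \<in> carrier_mat p p" "B \<in> carrier_mat p p"
  shows "dsum_one A r * dsum_one B r = dsum_one (A * B) r"
proof -
  have "dsum_one A r * dsum_one B r = four_block_mat (A * B + 0\<^sub>m p r * 0\<^sub>m r p) (A * 0\<^sub>m p r + 0\<^sub>m p r * 1\<^sub>m r)
      (0\<^sub>m r p * B + 1\<^sub>m r * 0\<^sub>m r p) (0\<^sub>m r p * 0\<^sub>m p r + 1\<^sub>m r * 1\<^sub>m r)"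
    unfolding dsum_one_def carrier_matD[OF assms(1)] carrier_matD[OF assms(2)]
    by (rule mult_four_block_mat[OF assms(1) zero_carrier_mat zero_carrier_mat one_carrier_mat
          assms(2) zero_carrier_mat zero_carrier_mat one_carrier_mat])
  also have "\<dots> = dsum_one (A * B) r"
    unfolding dsum_one_def using assms by (intro cong_four_block_mat) simp_all
  finally show ?thesis .
qed

lemma dsum_one_one: "dsum_one (1\<^sub>m p) r = 1\<^sub>m (p + r)"
  by (simp add: dsum_one_def)

lemma dsum_one_adjoint:
  assumes "A \<in> carrier_mat p p" shows "mat_adjoint (dsum_one A r) = dsum_one (mat_adjoint A) r"
proof (rule eq_matI)
  fix i j assume "i < dim_row (dsum_one (mat_adjoint A) r)" "j < dim_col (dsum_one (mat_adjoint A) r)"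
  then show "mat_adjoint (dsum_one A r) $$ (i, j) = dsum_one (mat_adjoint A) r $$ (i, j)"
    using assms by (auto simp: dsum_one_def)
qed (use assms in \<open>simp_all add: dsum_one_def\<close>)

lemma unitary_dsum_one:
  assumes "A \<in> carrier (unitary_group p)"
  shows "dsum_one A r \<in> carrier (unitary_group (p + r))"
proof -
  note a = unitary_groupD[OF assms]
  note aa = mat_adjoint_carrier[OF a(1)]
  show ?thesis
  proof (rule unitary_groupI)
    show "mat_adjoint (dsum_one A r) * dsum_one A r = 1\<^sub>m (p + r)"
      unfolding dsum_one_adjoint[OF a(1)] dsum_one_mult[OF aa a(1)] a(2) by (rule dsum_one_one)
    show "dsum_one A r * mat_adjoint (dsum_one A r) = 1\<^sub>m (p + r)"
      unfolding dsum_one_adjoint[OF a(1)] dsum_one_mult[OF a(1) aa] a(3) by (rule dsum_one_one)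
  qed (rule dsum_one_carrier[OF a(1)])
qed

text \<open>About half of the \<open>N\<close> dimensions carry copies of \<open>v\<close>, the other half is trivial. The unitary
  that swaps the copies with trivial coordinates then fails to commute with the result by an amount,
  in the normalised Hilbert-Schmidt norm, that does not depend on \<open>N\<close>.\<close>

definition amplify :: "nat \<Rightarrow> nat \<Rightarrow> complex mat \<Rightarrow> complex mat" where
  "amplify d N v = dsum_one (kron (1\<^sub>m (N div (2 * d))) v) (N - N div (2 * d) * d)"

lemma amplify_dim: "N div (2 * d) * d + N div (2 * d) * d \<le> (N::nat)"
proof -
  have "N div (2 * d) * (2 * d) \<le> N" by (rule div_times_less_eq_dividend)
  then show ?thesis by (simp add: algebra_simps)
qed

lemma amplify_unitary:
  assumes "v \<in> carrier (unitary_group d)" shows "amplify d N v \<in> carrier (unitary_group N)"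
proof -
  have "N div (2 * d) * d + (N - N div (2 * d) * d) = N" using amplify_dim[of N d] by simp
  then show ?thesis
    using unitary_dsum_one[OF unitary_kron[OF unitary_one assms], of "N div (2 * d)" "N - N div (2 * d) * d"]
    unfolding amplify_def by simp
qed

lemma amplify_mult:
  assumes "v \<in> carrier_mat d d" "w \<in> carrier_mat d d"
  shows "amplify d N v * amplify d N w = amplify d N (v * w)"
proof -
  let ?m = "N div (2 * d)"
  note c = kron_carrier[OF one_carrier_mat[of ?m]]
  show ?thesis
    unfolding amplify_def dsum_one_mult[OF c[OF assms(1)] c[OF assms(2)]]
      kron_mult[OF one_carrier_mat one_carrier_mat assms] by simp
qed

lemma amplify_hom:
  assumes "\<phi> \<in> hom G (unitary_group d)"
  shows "(\<lambda>g. amplify d N (\<phi> g)) \<in> hom G (unitary_group N)"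
proof (rule homI)
  fix g assume "g \<in> carrier G"
  then show "amplify d N (\<phi> g) \<in> carrier (unitary_group N)"
    using hom_in_carrier[OF assms] by (intro amplify_unitary)
next
  fix g h assume gh: "g \<in> carrier G" "h \<in> carrier G"
  have "\<phi> (g \<otimes>\<^bsub>G\<^esub> h) = \<phi> g * \<phi> h"
    using hom_mult[OF assms gh] by (simp add: unitary_group_def)
  then show "amplify d N (\<phi> (g \<otimes>\<^bsub>G\<^esub> h)) = amplify d N (\<phi> g) \<otimes>\<^bsub>unitary_group N\<^esub> amplify d N (\<phi> h)"
    using amplify_mult[of "\<phi> g" d "\<phi> h" N] unitary_groupD(1)[OF hom_in_carrier[OF assms gh(1)]]
      unitary_groupD(1)[OF hom_in_carrier[OF assms gh(2)]]
    by (simp add: unitary_group_def)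
qed

section \<open>The swap unitary and its defect under conjugation\<close>

definition swap_index :: "nat \<Rightarrow> nat \<Rightarrow> nat" where
  "swap_index p i = (if i < p then i + p else if i < p + p then i - p else i)"

definition swap_mat :: "nat \<Rightarrow> nat \<Rightarrow> complex mat" where
  "swap_mat p N = Matrix.mat N N (\<lambda>(i, j). if i = swap_index p j then 1 else 0)"

lemma swap_index_swap_index: "swap_index p (swap_index p i) = i"
  by (auto simp: swap_index_def)

lemma swap_index_less: "p + p \<le> N \<Longrightarrow> i < N \<Longrightarrow> swap_index p i < N"
  by (auto simp: swap_index_def)

lemma swap_mat_unitary:
  assumes p: "p + p \<le> N" shows "swap_mat p N \<in> carrier (unitary_group N)"
proof -
  let ?S = "swap_mat p N"
  have S: "?S \<in> carrier_mat N N" by (simp add: swap_mat_def)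
  have adj: "mat_adjoint ?S = ?S"
  proof (rule eq_matI)
    fix i j assume "i < dim_row ?S" "j < dim_col ?S"
    then have "i < N" "j < N" by (simp_all add: swap_mat_def)
    moreover have "j = swap_index p i \<longleftrightarrow> i = swap_index p j" using swap_index_swap_index by metis
    ultimately show "mat_adjoint ?S $$ (i, j) = ?S $$ (i, j)" by (simp add: swap_mat_def)
  qed (simp_all add: swap_mat_def)
  have "?S * ?S = 1\<^sub>m N"
  proof (rule eq_matI)
    fix i j assume "i < dim_row (1\<^sub>m N :: complex mat)" "j < dim_col (1\<^sub>m N :: complex mat)"
    then have ij: "i < N" "j < N" by simp_all
    then have "(?S * ?S) $$ (i, j) = (\<Sum>k<N. ?S $$ (i, k) * ?S $$ (k, j))"
      using S by (subst mult_mat_index) auto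
    also have "\<dots> = (\<Sum>k<N. if k = swap_index p j then (if i = j then 1 else 0) else 0)"
      using ij by (intro sum.cong) (auto simp: swap_mat_def swap_index_swap_index)
    also have "\<dots> = 1\<^sub>m N $$ (i, j)"
      using ij swap_index_less[OF p ij(2)] by simp
    finally show "(?S * ?S) $$ (i, j) = 1\<^sub>m N $$ (i, j)" .
  qed (use S in auto)
  then show ?thesis using S by (intro unitary_groupI) (simp_all add: adj)
qed

text \<open>On the first \<open>2 * p\<close> coordinates \<open>u\<close> is A \<oplus> 1 and
  \<open>S\<close> exchanges the two halves, so the upper right corner is A in
  \<open>u * S * mat_adjoint u\<close> and 1 in \<open>S\<close>. This corner of the difference
  alone contributes \<open>hs_sq (1\<^sub>m p - A)\<close>.\<close>

lemma swap_dsum_one_defect: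
  assumes A: "A \<in> carrier_mat p p" and p: "p + p \<le> N"
  defines "u \<equiv> dsum_one A (N - p)" and "S \<equiv> swap_mat p N"
  shows "hs_sq (1\<^sub>m p - A) \<le> hs_sq (S - u * S * mat_adjoint u)"
proof -
  have u: "u \<in> carrier_mat N N" using dsum_one_carrier[OF A, of "N - p"] p by (simp add: u_def)
  have S: "S \<in> carrier_mat N N" by (simp add: S_def swap_mat_def)
  have ua: "mat_adjoint u \<in> carrier_mat N N" using u by (rule mat_adjoint_carrier)
  note uS = mult_carrier_mat[OF u S]
  have entry: "(S - u * S * mat_adjoint u) $$ (i, p + j) = (1\<^sub>m p - A) $$ (i, j)" if ij: "i < p" "j < p" for i j
  proof -
    have N: "i < N" "p + j < N" "j < N" using ij p by auto
    have "(u * S * mat_adjoint u) $$ (i, p + j) = (\<Sum>k<N. (u * S) $$ (i, k) * mat_adjoint u $$ (k, p + j))"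
      using uS ua N u by (subst mult_mat_index) auto
    also have "\<dots> = (\<Sum>k<N. if k = p + j then (u * S) $$ (i, k) else 0)"
      using u N ij A by (intro sum.cong) (auto simp: u_def dsum_one_def)
    also have "\<dots> = (u * S) $$ (i, p + j)" using N by simp
    also have "\<dots> = (\<Sum>k<N. u $$ (i, k) * S $$ (k, p + j))"
      using u S N by (subst mult_mat_index) auto
    also have "\<dots> = (\<Sum>k<N. if k = j then u $$ (i, k) else 0)"
      using N ij by (intro sum.cong) (auto simp: S_def swap_mat_def swap_index_def)
    also have "\<dots> = u $$ (i, j)" using N by simp
    also have "\<dots> = A $$ (i, j)" using A ij by (simp add: u_def dsum_one_def)
    finally have "(u * S * mat_adjoint u) $$ (i, p + j) = A $$ (i, j)" .
    moreover have "S $$ (i, p + j) = 1\<^sub>m p $$ (i, j)"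
      using N ij by (simp add: S_def swap_mat_def swap_index_def)
    ultimately show ?thesis using u N A ij by simp
  qed
  let ?T = "S - u * S * mat_adjoint u"
  have T: "dim_row ?T = N" "dim_col ?T = N" using u by auto
  have "hs_sq (1\<^sub>m p - A) = (\<Sum>i<p. \<Sum>j<p. (cmod (?T $$ (i, p + j)))\<^sup>2)"
    unfolding hs_sq_def using A by (intro sum.cong) (auto simp only: entry index_minus_mat carrier_matD lessThan_iff)
  also have "\<dots> = (\<Sum>i<p. \<Sum>j\<in>{p..<p + p}. (cmod (?T $$ (i, j)))\<^sup>2)"
  proof (rule sum.cong[OF refl])
    fix i
    show "(\<Sum>j<p. (cmod (?T $$ (i, p + j)))\<^sup>2) = (\<Sum>j\<in>{p..<p + p}. (cmod (?T $$ (i, j)))\<^sup>2)"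
      using sum.shift_bounds_nat_ivl[of "\<lambda>j. (cmod (?T $$ (i, j)))\<^sup>2" 0 p p]
      by (simp add: lessThan_atLeast0 add.commute)
  qed
  also have "\<dots> \<le> (\<Sum>i<p. \<Sum>j<N. (cmod (?T $$ (i, j)))\<^sup>2)"
    using p by (intro sum_mono sum_mono2) auto
  also have "\<dots> \<le> (\<Sum>i<N. \<Sum>j<N. (cmod (?T $$ (i, j)))\<^sup>2)"
    using p by (intro sum_mono2) (auto intro: sum_nonneg)
  also have "\<dots> = hs_sq ?T" unfolding hs_sq_def T by (rule refl)
  finally show ?thesis .
qed

text \<open>Each of the m = \<open>N div (2 * d)\<close> copies contributes
  \<open>hs_sq (1\<^sub>m d - v)\<close>, so the normalised defect is at least m / N times this
  number, and m / N \<ge> 1 / (4 d).\<close>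

lemma amplify_defect:
  assumes v: "v \<in> carrier_mat d d" and d: "d > 0" and N: "2 * d \<le> N"
  obtains b where "b \<in> carrier (unitary_group N)"
    "hs_sq (1\<^sub>m d - v) / (4 * real d) \<le>
      hs_sq (b - amplify d N v * b * mat_adjoint (amplify d N v)) / real N"
proof
  define m where "m = N div (2 * d)"
  have md: "m * d + m * d \<le> N" unfolding m_def by (rule amplify_dim)
  show "swap_mat (m * d) N \<in> carrier (unitary_group N)" using md by (rule swap_mat_unitary)
  have "m \<ge> 1" unfolding m_def using N d by (simp add: Suc_le_eq div_greater_zero_iff)
  \<comment> \<open>The remainder of the division is below \<open>2 * d\<close>, and
    \<open>2 * d\<close> is at most \<open>2 * d * m\<close> because there is at least one copy;
    this doubling turns 2 d into the constant 4 d.\<close>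
  have lt: "N < 2 * d * m + 2 * d"
    unfolding m_def using d by (metis add.commute dividend_less_times_div mult_2 nat_0_less_mult_iff zero_less_numeral)
  have "2 * d \<le> 2 * d * m" using \<open>m \<ge> 1\<close> by simp
  then have "N \<le> 4 * d * m" using lt by linarith
  then have "real N \<le> real (4 * d * m)" by (rule of_nat_mono)
  then have Nm: "real N \<le> real m * (4 * real d)" by (simp add: mult.commute)
  let ?c = "hs_sq (1\<^sub>m d - v)"
  have "hs_sq (1\<^sub>m m) = real m"
  proof -
    have "hs_sq (1\<^sub>m m) = (\<Sum>i<m. \<Sum>j<m. if j = i then 1 else 0)"
      unfolding hs_sq_def by (intro sum.cong) auto
    then show ?thesis by simp
  qed
  then have "real m * ?c = hs_sq (kron (1\<^sub>m m) (1\<^sub>m d - v))" by (simp add: hs_sq_kron)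
  also have "kron (1\<^sub>m m) (1\<^sub>m d - v) = 1\<^sub>m (m * d) - kron (1\<^sub>m m) v"
    using kron_minus_right[OF one_carrier_mat v] by simp
  also have "hs_sq \<dots> \<le> hs_sq (swap_mat (m * d) N - amplify d N v * swap_mat (m * d) N * mat_adjoint (amplify d N v))"
    unfolding amplify_def m_def[symmetric]
    by (rule swap_dsum_one_defect[OF kron_carrier[OF one_carrier_mat v] md])
  finally have le: "real m * ?c \<le> hs_sq (swap_mat (m * d) N - amplify d N v * swap_mat (m * d) N * mat_adjoint (amplify d N v))" .
  have "?c * real N \<le> ?c * (real m * (4 * real d))"
    using Nm hs_sq_nonneg by (rule mult_left_mono)
  then have "?c / (4 * real d) \<le> (real m * ?c) / real N"
    using d N by (simp add: field_simps)
  also have "\<dots> \<le> hs_sq (swap_mat (m * d) N - amplify d N v * swap_mat (m * d) N * mat_adjoint (amplify d N v)) / real N"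
    using le by (rule divide_right_mono) simp
  finally show "?c / (4 * real d) \<le> hs_sq (swap_mat (m * d) N -
      amplify d N v * swap_mat (m * d) N * mat_adjoint (amplify d N v)) / real N" .
qed

lemma hs_sq_pos:
  assumes "A \<in> carrier_mat m n" "B \<in> carrier_mat m n" "A \<noteq> B" shows "hs_sq (A - B) > 0"
proof (rule ccontr)
  assume "\<not> ?thesis"
  then have "hs_sq (A - B) = 0" using hs_sq_nonneg[of "A - B"] by linarith
  then have z: "\<forall>i<m. \<forall>j<n. (cmod ((A - B) $$ (i, j)))\<^sup>2 = 0"
    using assms unfolding hs_sq_def by (simp add: sum_nonneg_eq_0_iff sum_nonneg)
  have "A = B"
  proof (rule eq_matI)
    fix i j assume ij: "i < dim_row B" "j < dim_col B"
    then have "(A - B) $$ (i, j) = 0" using z assms by simp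
    then show "A $$ (i, j) = B $$ (i, j)" using ij by simp
  qed (use assms in auto)
  then show False using assms(3) by simp
qed

section \<open>Product type automorphisms\<close>

lemma unitary_conj_mult:
  fixes w :: "'a::cstar_algebra"
  assumes "unitary_elem w" shows "w * y * star w * (w * z * star w) = w * (y * z) * star w"
proof -
  have w: "star w * w = 1" using assms by (simp add: unitary_elem_def)
  have "w * y * star w * (w * z * star w) = w * y * (star w * w) * z * star w"
    by (simp only: mult.assoc)
  also have "\<dots> = w * (y * z) * star w" by (simp only: w mult_1_right mult.assoc)
  finally show ?thesis .
qed

context tensor_identification
begin

definition unitary_seq :: "(nat \<Rightarrow> complex mat) \<Rightarrow> bool" where
  "unitary_seq u \<longleftrightarrow> (\<forall>l. u l \<in> carrier (unitary_group (n l)))"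

definition W :: "(nat \<Rightarrow> complex mat) \<Rightarrow> nat \<Rightarrow> 'a" where
  "W u k = \<iota> k (kron_upto u k)"

text \<open>A pointwise limit of inner automorphisms on the whole algebra, so that compatibility
  with the algebraic operations and with \<open>star\<close> passes directly to the limit.\<close>

definition Ad_lim :: "(nat \<Rightarrow> complex mat) \<Rightarrow> 'a \<Rightarrow> 'a" where
  "Ad_lim u x = lim (\<lambda>k. W u k * x * star (W u k))"

lemma unitary_seqD: "unitary_seq u \<Longrightarrow> u l \<in> carrier (unitary_group (n l))"
  by (simp add: unitary_seq_def)

lemma unitary_kron_upto:
  assumes "unitary_seq u" shows "kron_upto u k \<in> carrier (unitary_group (N k))"
proof (induction k)
  case 0
  show ?case using unitary_one[of 1] by (simp add: N_def)
next
  case (Suc k)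
  show ?case
    unfolding kron_upto.simps N_Suc by (rule unitary_kron[OF Suc unitary_seqD[OF assms]])
qed

lemma unitary_elem_\<iota>:
  assumes "U \<in> carrier (unitary_group (N k))" shows "unitary_elem (\<iota> k U)"
proof -
  note u = unitary_groupD[OF assms]
  note ua = mat_adjoint_carrier[OF u(1)]
  have "star (\<iota> k U) * \<iota> k U = \<iota> k (mat_adjoint U * U)" "\<iota> k U * star (\<iota> k U) = \<iota> k (U * mat_adjoint U)"
    by (simp_all only: \<iota>_adjoint[OF u(1)] \<iota>_mult[OF ua u(1)] \<iota>_mult[OF u(1) ua])
  then show ?thesis by (simp add: unitary_elem_def u(2,3) \<iota>_one)
qed

lemma unitary_W: "unitary_seq u \<Longrightarrow> unitary_elem (W u k)"
  unfolding W_def by (intro unitary_elem_\<iota> unitary_kron_upto)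

lemma \<iota>_conj:
  assumes "U \<in> M k" "a \<in> M k" shows "\<iota> k (U * a * mat_adjoint U) = \<iota> k U * \<iota> k a * star (\<iota> k U)"
  by (simp only: \<iota>_mult[OF mult_carrier_mat[OF assms] mat_adjoint_carrier[OF assms(1)]]
      \<iota>_mult[OF assms] \<iota>_adjoint[OF assms(1)])

text \<open>In the next stage the element is a \<otimes> 1, and the additional unitary factor
  conjugates only the identity.\<close>

lemma W_conj_Suc:
  assumes u: "unitary_seq u" and a: "a \<in> M k"
  shows "W u (Suc k) * \<iota> k a * star (W u (Suc k)) = W u k * \<iota> k a * star (W u k)"
proof -
  note U = unitary_groupD(1)[OF unitary_kron_upto[OF u]]
  note v = unitary_groupD(1)[OF unitary_seqD[OF u, of k]]
  have a1: "kron a (1\<^sub>m (n k)) \<in> M (Suc k)"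
    unfolding N_Suc by (rule kron_carrier[OF a one_carrier_mat])
  have "W u (Suc k) * \<iota> k a * star (W u (Suc k)) =
      \<iota> (Suc k) (kron_upto u (Suc k) * kron a (1\<^sub>m (n k)) * mat_adjoint (kron_upto u (Suc k)))"
    unfolding W_def \<iota>_conj[OF U a1] \<iota>_Suc[OF a] ..
  also have "kron_upto u (Suc k) * kron a (1\<^sub>m (n k)) * mat_adjoint (kron_upto u (Suc k)) =
      kron (kron_upto u k * a * mat_adjoint (kron_upto u k)) (1\<^sub>m (n k))"
    unfolding kron_upto.simps kron_conj[OF U a v one_carrier_mat] unitary_conj_one[OF unitary_seqD[OF u]] ..
  also have "\<iota> (Suc k) \<dots> = \<iota> k (kron_upto u k * a * mat_adjoint (kron_upto u k))"
    by (rule \<iota>_Suc) (intro mult_carrier_mat[of _ "N k" "N k"] mat_adjoint_carrier U a)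
  also have "\<dots> = W u k * \<iota> k a * star (W u k)"
    unfolding W_def by (rule \<iota>_conj[OF U a])
  finally show ?thesis .
qed

lemma W_conj_stage:
  assumes u: "unitary_seq u" and a: "a \<in> M k" and "k \<le> j"
  shows "W u j * \<iota> k a * star (W u j) = W u k * \<iota> k a * star (W u k)"
  using assms(3)
proof (induction j rule: dec_induct)
  case (step j)
  obtain b where b: "b \<in> M j" "\<iota> k a = \<iota> j b" by (rule D_lift[OF a step(1)])
  have "W u (Suc j) * \<iota> k a * star (W u (Suc j)) = W u j * \<iota> k a * star (W u j)"
    unfolding b(2) by (rule W_conj_Suc[OF u b(1)])
  then show ?case using step.IH by simp
qed simp

lemma norm_W_conj_diff_le:
  assumes "unitary_seq u"
  shows "norm (W u k * x * star (W u k) - W u k * y * star (W u k)) \<le> norm (x - y)"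
proof -
  have "W u k * x * star (W u k) - W u k * y * star (W u k) = W u k * (x - y) * star (W u k)"
    by (simp only: left_diff_distrib right_diff_distrib)
  then show ?thesis using norm_conjugate_unitary_le[OF unitary_W[OF assms]] by simp
qed

lemma D_approx:
  assumes "e > 0" obtains d where "d \<in> D" "dist d x < e"
proof -
  have "x \<in> closure D" by (simp add: closure_D)
  then have "\<exists>d\<in>D. dist d x < e" using assms by (simp add: closure_approachable)
  then show ?thesis using that by blast
qed

text \<open>On a finite stage the conjugations are eventually constant. As they do not increase
  distances, approximation by finite stages makes the sequence Cauchy for every
  \<open>x\<close>.\<close>

lemma Ad_lim_tendsto:
  assumes u: "unitary_seq u" shows "(\<lambda>k. W u k * x * star (W u k)) \<longlonglongrightarrow> Ad_lim u x"
proof -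
  have "Cauchy (\<lambda>k. W u k * x * star (W u k))"
  proof (rule metric_CauchyI)
    fix e :: real assume e: "e > 0"
    obtain d where d: "d \<in> D" "dist d x < e / 2" by (rule D_approx[OF half_gt_zero[OF e]])
    obtain k a where a: "a \<in> M k" "d = \<iota> k a" using d(1) by (rule D_cases)
    have "dist (W u i * x * star (W u i)) (W u k * d * star (W u k)) < e / 2" if "i \<ge> k" for i
    proof -
      have "W u k * d * star (W u k) = W u i * d * star (W u i)"
        unfolding a(2) by (rule W_conj_stage[OF u a(1) that, symmetric])
      then show ?thesis
        using norm_W_conj_diff_le[OF u, of i x d] d(2) by (simp add: dist_norm norm_minus_commute)
    qed
    then show "\<exists>m. \<forall>i\<ge>m. \<forall>j\<ge>m. dist (W u i * x * star (W u i)) (W u j * x * star (W u j)) < e"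
      using dist_triangle_half_l by blast
  qed
  then show ?thesis unfolding Ad_lim_def by (simp add: Cauchy_convergent convergent_LIMSEQ_iff[symmetric])
qed

lemma Ad_lim_stage:
  assumes u: "unitary_seq u" and a: "a \<in> M k"
  shows "Ad_lim u (\<iota> k a) = \<iota> k (kron_upto u k * a * mat_adjoint (kron_upto u k))"
proof (rule LIMSEQ_unique[OF Ad_lim_tendsto[OF u]], rule tendsto_eventually,
    rule eventually_sequentiallyI)
  fix j assume "k \<le> j"
  note U = unitary_groupD(1)[OF unitary_kron_upto[OF u]]
  show "W u j * \<iota> k a * star (W u j) = \<iota> k (kron_upto u k * a * mat_adjoint (kron_upto u k))"
    unfolding W_conj_stage[OF u a \<open>k \<le> j\<close>] \<iota>_conj[OF U a] by (simp only: W_def)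
qed

text \<open>Makes left multiplication by \<open>Ad_lim u (\<iota> k U)\<close> preserve the trace
  seminorm, as the final estimate requires.\<close>

lemma Ad_lim_unitary:
  assumes "unitary_seq u" "U \<in> carrier (unitary_group (N k))"
  shows "unitary_elem (Ad_lim u (\<iota> k U))"
proof -
  have "unitary_elem (W u k * \<iota> k U * star (W u k))"
  proof -
    note w = unitary_W[OF assms(1), of k, unfolded unitary_elem_def]
      and b = unitary_elem_\<iota>[OF assms(2), unfolded unitary_elem_def]
    have s: "star (W u k * \<iota> k U * star (W u k)) = W u k * star (\<iota> k U) * star (W u k)"
      by (simp only: star_mult star_star mult.assoc)
    show ?thesis
      unfolding unitary_elem_def s
      by (simp only: unitary_conj_mult[OF unitary_W[OF assms(1)]] b w mult_1_right simp_thms)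
  qed
  moreover have "Ad_lim u (\<iota> k U) = W u k * \<iota> k U * star (W u k)"
    unfolding Ad_lim_stage[OF assms(1) unitary_groupD(1)[OF assms(2)]] W_def
    by (rule \<iota>_conj[OF unitary_groupD(1)[OF unitary_kron_upto[OF assms(1)]] unitary_groupD(1)[OF assms(2)]])
  ultimately show ?thesis by simp
qed

lemma kron_upto_mult:
  assumes "unitary_seq u" "unitary_seq v"
  shows "kron_upto (\<lambda>l. u l * v l) k = kron_upto u k * kron_upto v k"
proof (induction k)
  case (Suc k)
  note U = unitary_groupD(1)[OF unitary_kron_upto] and V = unitary_groupD(1)[OF unitary_seqD]
  show ?case
    unfolding kron_upto.simps Suc
    by (rule kron_mult[OF U[OF assms(1)] U[OF assms(2)] V[OF assms(1)] V[OF assms(2)], symmetric])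
qed simp

lemma W_mult:
  assumes "unitary_seq u" "unitary_seq v" shows "W (\<lambda>l. u l * v l) k = W u k * W v k"
proof -
  note U = unitary_groupD(1)[OF unitary_kron_upto]
  show ?thesis unfolding W_def kron_upto_mult[OF assms] by (rule \<iota>_mult[OF U[OF assms(1)] U[OF assms(2)]])
qed

text \<open>In a composition of conjugations both layers vary with \<open>k\<close>. Since the outer
  ones are contractive uniformly in \<open>k\<close>, the inner sequence may be replaced by its
  limit with an error tending to 0.\<close>

lemma Ad_lim_mult:
  assumes u: "unitary_seq u" and v: "unitary_seq v" and uv: "unitary_seq (\<lambda>l. u l * v l)"
  shows "Ad_lim (\<lambda>l. u l * v l) x = Ad_lim u (Ad_lim v x)"
proof (rule LIMSEQ_unique[OF Ad_lim_tendsto[OF uv]])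
  let ?y = "Ad_lim v x"
  have "(\<lambda>k. norm (W v k * x * star (W v k) - ?y)) \<longlonglongrightarrow> 0"
    using Ad_lim_tendsto[OF v, of x] by (simp add: tendsto_norm_zero LIM_zero)
  then have "(\<lambda>k. W u k * (W v k * x * star (W v k)) * star (W u k) - W u k * ?y * star (W u k)) \<longlonglongrightarrow> 0"
    by (rule Lim_null_comparison[rotated]) (intro always_eventually allI norm_W_conj_diff_le u)
  from tendsto_add[OF this Ad_lim_tendsto[OF u, of ?y]]
  show "(\<lambda>k. W (\<lambda>l. u l * v l) k * x * star (W (\<lambda>l. u l * v l) k)) \<longlonglongrightarrow> Ad_lim u ?y"
    by (simp add: W_mult[OF u v] star_mult mult.assoc)
qed

lemma unitary_seq_one: "unitary_seq (\<lambda>l. 1\<^sub>m (n l))"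
  by (simp add: unitary_seq_def unitary_one)

lemma Ad_lim_one: "Ad_lim (\<lambda>l. 1\<^sub>m (n l)) x = x"
proof -
  have "kron_upto (\<lambda>l. 1\<^sub>m (n l)) k = 1\<^sub>m (N k)" for k
    by (induction k) (simp_all add: N_Suc, simp add: N_def)
  then have "W (\<lambda>l. 1\<^sub>m (n l)) k = 1" for k by (simp add: W_def \<iota>_one)
  then show ?thesis using Ad_lim_tendsto[OF unitary_seq_one, of x] by (simp add: LIMSEQ_const_iff)
qed

lemma unitary_seq_adjoint: "unitary_seq u \<Longrightarrow> unitary_seq (\<lambda>l. mat_adjoint (u l))"
  by (simp add: unitary_seq_def unitary_adjoint)

lemma Ad_lim_inverse:
  assumes u: "unitary_seq u"
  shows "Ad_lim u (Ad_lim (\<lambda>l. mat_adjoint (u l)) x) = x" "Ad_lim (\<lambda>l. mat_adjoint (u l)) (Ad_lim u x) = x"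
proof -
  have 1: "(\<lambda>l. u l * mat_adjoint (u l)) = (\<lambda>l. 1\<^sub>m (n l))" "(\<lambda>l. mat_adjoint (u l) * u l) = (\<lambda>l. 1\<^sub>m (n l))"
    using unitary_groupD(2,3)[OF unitary_seqD[OF u]] by auto
  show "Ad_lim u (Ad_lim (\<lambda>l. mat_adjoint (u l)) x) = x"
    using Ad_lim_mult[OF u unitary_seq_adjoint[OF u], of x] unfolding 1 by (simp add: unitary_seq_one Ad_lim_one)
  show "Ad_lim (\<lambda>l. mat_adjoint (u l)) (Ad_lim u x) = x"
    using Ad_lim_mult[OF unitary_seq_adjoint[OF u] u, of x] unfolding 1 by (simp add: unitary_seq_one Ad_lim_one)
qed

lemma star_automorphism_Ad_lim:
  assumes u: "unitary_seq u" shows "star_automorphism (Ad_lim u)"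
proof -
  note lim = Ad_lim_tendsto[OF u]
  have "bij (Ad_lim u)"
    by (rule o_bij[where g = "Ad_lim (\<lambda>l. mat_adjoint (u l))"])
      (simp_all only: o_def id_def Ad_lim_inverse[OF u])
  moreover have "Ad_lim u (x + y) = Ad_lim u x + Ad_lim u y" for x y
    by (rule LIMSEQ_unique[OF lim]) (use tendsto_add[OF lim lim, of x y] in \<open>simp add: distrib_left distrib_right\<close>)
  moreover have "Ad_lim u (c *\<^sub>C x) = c *\<^sub>C Ad_lim u x" for c x
    by (rule LIMSEQ_unique[OF lim])
      (use tendsto_scaleC[OF lim, of c x] in \<open>simp add: mult_scaleC_left mult_scaleC_right\<close>)
  moreover have "Ad_lim u (x * y) = Ad_lim u x * Ad_lim u y" for x y
  proof (rule LIMSEQ_unique[OF lim])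
    have "W u k * x * star (W u k) * (W u k * y * star (W u k)) = W u k * (x * y) * star (W u k)" for k
      by (rule unitary_conj_mult[OF unitary_W[OF u]])
    then show "(\<lambda>k. W u k * (x * y) * star (W u k)) \<longlonglongrightarrow> Ad_lim u x * Ad_lim u y"
      using tendsto_mult[OF lim lim, of x y] by simp
  qed
  moreover have "Ad_lim u (star x) = star (Ad_lim u x)" for x
    by (rule LIMSEQ_unique[OF lim]) (use tendsto_star[OF lim, of x] in \<open>simp add: star_mult star_star mult.assoc\<close>)
  ultimately show ?thesis by (simp add: star_automorphism_def)
qed

lemma product_type_action_Ad_lim:
  assumes \<rho>: "\<rho> \<in> hom G (product_group UNIV (\<lambda>l. unitary_group (n l)))"
  shows "product_type_action G (\<lambda>g. Ad_lim (\<rho> g))"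
proof -
  have us: "unitary_seq (\<rho> g)" if "g \<in> carrier G" for g
    using hom_in_carrier[OF \<rho> that] by (auto simp: unitary_seq_def)
  have mult: "\<rho> (g \<otimes>\<^bsub>G\<^esub> h) = (\<lambda>l. \<rho> g l * \<rho> h l)" if "g \<in> carrier G" "h \<in> carrier G" for g h
    using hom_mult[OF \<rho> that] by (simp add: product_group_def unitary_group_def restrict_UNIV)
  have "(\<lambda>g. Ad_lim (\<rho> g)) \<in> hom G Aut_group"
  proof (rule homI)
    fix g h assume gh: "g \<in> carrier G" "h \<in> carrier G"
    show "Ad_lim (\<rho> (g \<otimes>\<^bsub>G\<^esub> h)) = Ad_lim (\<rho> g) \<otimes>\<^bsub>Aut_group\<^esub> Ad_lim (\<rho> h)"
    proof
      fix x
      have "unitary_seq (\<lambda>l. \<rho> g l * \<rho> h l)"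
        unfolding unitary_seq_def
      proof
        fix l
        note u = unitary_seqD[OF us[OF gh(1)], of l] and v = unitary_seqD[OF us[OF gh(2)], of l]
        show "\<rho> g l * \<rho> h l \<in> carrier (unitary_group (n l))"
          by (rule unitary_mult[OF u v])
      qed
      then show "Ad_lim (\<rho> (g \<otimes>\<^bsub>G\<^esub> h)) x = (Ad_lim (\<rho> g) \<otimes>\<^bsub>Aut_group\<^esub> Ad_lim (\<rho> h)) x"
        unfolding mult[OF gh] by (simp add: Aut_group_def Ad_lim_mult us gh)
    qed
  qed (simp add: Aut_group_def star_automorphism_Ad_lim us)
  moreover have "is_tensor_Ad n \<iota> (\<rho> g) (Ad_lim (\<rho> g))" if "g \<in> carrier G" for g
    unfolding is_tensor_Ad_def
    using star_automorphism_Ad_lim[OF us[OF that]] Ad_lim_stage[OF us[OF that]] by (simp add: N_def)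
  ultimately show ?thesis
    unfolding product_type_action_def using n_pos identification \<rho> by blast
qed

text \<open>If \<open>w\<close> implements \<open>Ad_lim u\<close> on the GNS space, approximate it by \<open>d\<close> in a finite stage.
  A unitary \<open>B\<close> of a later tensor factor commutes with \<open>d\<close>, so \<open>(B - Ad_lim u B) d\<close> is small;
  but \<open>B - Ad_lim u B\<close> and \<open>d\<close> are independent for the trace.\<close>

lemma not_weakly_inner_Ad_lim:
  assumes u: "unitary_seq u" and \<delta>: "\<delta> > 0"
    and defect: "\<And>k. \<exists>j\<ge>k. \<exists>b\<in>carrier (unitary_group (n j)).
      \<delta>\<^sup>2 \<le> hs_sq (b - u j * b * mat_adjoint (u j)) / real (n j)"
  shows "\<not> weakly_inner the_trace (Ad_lim u)"
proof
  assume wi: "weakly_inner the_trace (Ad_lim u)"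
  obtain X where X: "X \<in> gns_Cauchy the_trace" and nz: "\<not> (\<lambda>m. sn (X m)) \<longlonglongrightarrow> 0"
    and impl: "\<And>b. unitary_elem b \<Longrightarrow> (\<lambda>m. sn (X m * b - Ad_lim u b * X m)) \<longlonglongrightarrow> 0"
  proof (rule weakly_inner_vector[OF wi])
    fix X assume "X \<in> gns_Cauchy the_trace" "\<not> (\<lambda>m. sn (X m)) \<longlonglongrightarrow> 0"
      "\<And>b. unitary_elem b \<Longrightarrow> (\<lambda>m. sn (X m * b - Ad_lim u b * X m)) \<longlonglongrightarrow> 0"
    then show thesis by (rule that)
  qed
  \<comment> \<open>A sequence of nonnegative reals that is not null exceeds some fixed
    \<open>s > 0\<close> infinitely often; one such index beyond the Cauchy threshold will
    suffice.\<close>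
  obtain s where s: "s > 0" "\<And>m0. \<exists>m\<ge>m0. sn (X m) \<ge> s"
    using nz unfolding LIMSEQ_iff by (auto simp: sn_nonneg not_less)
  \<comment> \<open>Chosen to satisfy \<open>4 * \<epsilon> < (s - \<epsilon>) * \<delta>\<close>.
    The left side is the cost of twice replacing \<open>X m\<close> by \<open>d\<close>, at most
    \<open>2 * \<epsilon>\<close> each time; the right side is the lower bound for the
    defect.\<close>
  define \<epsilon> where "\<epsilon> = s * \<delta> / (5 + \<delta>)"
  have \<epsilon>: "\<epsilon> > 0" using s \<delta> by (simp add: \<epsilon>_def)
  have "\<epsilon> * (4 + \<delta>) < \<epsilon> * (5 + \<delta>)" using \<epsilon> by simp
  also have "\<dots> = s * \<delta>" using \<delta> by (simp add: \<epsilon>_def)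
  finally have strict: "4 * \<epsilon> < (s - \<epsilon>) * \<delta>" by (simp add: algebra_simps)
  obtain m1 where m1: "\<And>m m'. m \<ge> m1 \<Longrightarrow> m' \<ge> m1 \<Longrightarrow> sn (X m - X m') < \<epsilon>"
    using gns_CauchyD[OF X \<epsilon>] by blast
  obtain m0 where m0: "m0 \<ge> m1" "sn (X m0) \<ge> s" using s(2) by blast
  obtain d where d: "d \<in> D" "dist d (X m0) < \<epsilon>" by (rule D_approx[OF \<epsilon>])
  have dm0: "sn (X m0 - d) < \<epsilon>"
    using sn_le_norm[of "X m0 - d"] d(2) by (simp add: dist_norm norm_minus_commute)
  have dX: "sn (X m - d) \<le> 2 * \<epsilon>" if "m \<ge> m0" for m
    using sn_triangle_diff[of "X m" d "X m0"] m1[of m m0] dm0 m0 that by simp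
  have sd: "s - \<epsilon> \<le> sn d"
    using sn_triangle[of "X m0 - d" d] dm0 m0 by simp
  obtain k a0 where a0: "a0 \<in> M k" "d = \<iota> k a0" using d(1) by (rule D_cases)
  \<comment> \<open>The factor is picked after \<open>d\<close>, so it lies beyond the stage
    containing \<open>d\<close>.\<close>
  obtain j b where j: "j \<ge> k" and b: "b \<in> carrier (unitary_group (n j))"
    and def: "\<delta>\<^sup>2 \<le> hs_sq (b - u j * b * mat_adjoint (u j)) / real (n j)"
    using defect by blast
  obtain a where a: "a \<in> M j" "d = \<iota> j a" using D_lift[OF a0(1) j] a0(2) by metis
  define b' where "b' = u j * b * mat_adjoint (u j)"
  let ?U = "kron_upto u j" and ?I = "1\<^sub>m (N j) :: complex mat"
  note bc = unitary_groupD(1)[OF b] and uj = unitary_groupD(1)[OF unitary_seqD[OF u, of j]]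
  have b'c: "b' \<in> carrier_mat (n j) (n j)"
    unfolding b'_def by (intro mult_carrier_mat[of _ "n j" "n j"] mat_adjoint_carrier bc uj)
  have U: "?U \<in> M j" by (rule unitary_groupD(1)[OF unitary_kron_upto[OF u]])
  \<comment> \<open>Factors are counted from 0: the one with index \<open>j\<close> is absent from
    stage \<open>j\<close> and is the last leg of stage \<open>Suc j\<close>.\<close>
  define B where "B = \<iota> (Suc j) (kron ?I b)"
  have Bu: "kron ?I b \<in> carrier (unitary_group (N (Suc j)))"
    unfolding N_Suc by (rule unitary_kron[OF unitary_one b])
  have B: "unitary_elem B" unfolding B_def by (rule unitary_elem_\<iota>[OF Bu])
  have fBu: "unitary_elem (Ad_lim u B)" unfolding B_def by (rule Ad_lim_unitary[OF u Bu])
  have fB: "Ad_lim u B = \<iota> (Suc j) (kron ?I b')"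
    unfolding B_def Ad_lim_stage[OF u unitary_groupD(1)[OF Bu]] kron_upto.simps
      kron_conj[OF U one_carrier_mat uj bc] unitary_conj_one[OF unitary_kron_upto[OF u]] b'_def ..
  have kc: "kron x y \<in> M (Suc j)" if "x \<in> M j" "y \<in> carrier_mat (n j) (n j)" for x y
    unfolding N_Suc by (rule kron_carrier[OF that])
  \<comment> \<open>In stage \<open>Suc j\<close>, \<open>d\<close> is a \<otimes> 1,
    \<open>B\<close> is 1 \<otimes> b and \<open>Ad_lim u B\<close> is 1 \<otimes> b', so the
    commutator-like expression is an elementary tensor.\<close>
  have dB: "d * B - Ad_lim u B * d = \<iota> (Suc j) (kron a (b - b'))"
  proof -
    have d': "d = \<iota> (Suc j) (kron a (1\<^sub>m (n j)))" using a \<iota>_Suc[OF a(1)] by simp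
    have "d * B = \<iota> (Suc j) (kron a (1\<^sub>m (n j)) * kron ?I b)"
      unfolding d' B_def by (rule \<iota>_mult[symmetric]) (intro kc a one_carrier_mat bc)+
    also have "kron a (1\<^sub>m (n j)) * kron ?I b = kron a b"
      unfolding kron_mult[OF a(1) one_carrier_mat one_carrier_mat bc] using a(1) bc by simp
    finally have 1: "d * B = \<iota> (Suc j) (kron a b)" .
    have "Ad_lim u B * d = \<iota> (Suc j) (kron ?I b' * kron a (1\<^sub>m (n j)))"
      unfolding d' fB by (rule \<iota>_mult[symmetric]) (intro kc a one_carrier_mat b'c)+
    also have "kron ?I b' * kron a (1\<^sub>m (n j)) = kron a b'"
      unfolding kron_mult[OF one_carrier_mat a(1) b'c one_carrier_mat] using a(1) b'c by simp
    finally have 2: "Ad_lim u B * d = \<iota> (Suc j) (kron a b')" .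
    show ?thesis
      unfolding 1 2 kron_minus_right[OF bc b'c]
      by (rule \<iota>_diff[symmetric]) (intro kc a bc b'c)+
  qed
  \<comment> \<open>Lower bound: the seminorm of a \<otimes> (b - b') is the product of those of its
    legs, which are at least \<open>s - \<epsilon>\<close> and \<open>\<delta>\<close>.\<close>
  have "((s - \<epsilon>) * \<delta>)\<^sup>2 \<le> (sn d)\<^sup>2 * \<delta>\<^sup>2"
  proof -
    have "0 < (s - \<epsilon>) * \<delta>" using strict \<epsilon> by linarith
    then have "0 \<le> s - \<epsilon>" using \<delta> by (simp add: zero_less_mult_iff)
    then show ?thesis unfolding power_mult_distrib using sd by (intro mult_right_mono power_mono) auto
  qed
  also have "\<dots> \<le> (sn d)\<^sup>2 * (hs_sq (b - b') / real (n j))"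
    using def by (intro mult_left_mono) (simp_all add: b'_def)
  also have "\<dots> = hs_sq (kron a (b - b')) / real (N (Suc j))"
    unfolding a(2) sn_stage[OF a(1)] hs_sq_kron N_Suc by simp
  also have "\<dots> = (sn (d * B - Ad_lim u B * d))\<^sup>2"
    unfolding dB by (rule sn_stage[symmetric]) (intro kc a minus_carrier_mat b'c)
  finally have low: "(s - \<epsilon>) * \<delta> \<le> sn (d * B - Ad_lim u B * d)"
    by (rule power2_le_imp_le) (rule sn_nonneg)
  \<comment> \<open>Upper bound: passing from \<open>d\<close> to \<open>X m\<close> on either side
    costs \<open>sn (X m - d)\<close>, as multiplication by the unitary elements \<open>B\<close>
    and \<open>Ad_lim u B\<close> is isometric. What remains tends to 0 with
    \<open>m\<close>.\<close>
  have "(s - \<epsilon>) * \<delta> \<le> 4 * \<epsilon> + sn (X m * B - Ad_lim u B * X m)" if "m \<ge> m0" for m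
  proof -
    let ?f = "Ad_lim u B"
    have "sn (d * B - ?f * d) \<le> sn (d * B - X m * B) + sn (X m * B - ?f * d)"
      by (rule sn_triangle_diff)
    also have "sn (X m * B - ?f * d) \<le> sn (X m * B - ?f * X m) + sn (?f * X m - ?f * d)"
      by (rule sn_triangle_diff)
    also have "d * B - X m * B = (d - X m) * B" by (simp only: left_diff_distrib)
    also have "sn ((d - X m) * B) = sn (X m - d)" by (simp only: sn_mult_unitary[OF B] sn_minus_commute[of d])
    also have "?f * X m - ?f * d = ?f * (X m - d)" by (simp only: right_diff_distrib)
    also have "sn (?f * (X m - d)) = sn (X m - d)" by (rule sn_mult_unitary[OF fBu])
    finally show ?thesis using low dX[OF that] by linarith
  qed
  moreover have "(\<lambda>m. 4 * \<epsilon> + sn (X m * B - Ad_lim u B * X m)) \<longlonglongrightarrow> 4 * \<epsilon> + 0"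
    by (intro tendsto_add tendsto_const impl B)
  ultimately have "(s - \<epsilon>) * \<delta> \<le> 4 * \<epsilon> + 0"
    by (intro LIMSEQ_le_const) auto
  then show False using strict by simp
qed

text \<open>A cofinal subsequence of stages has the same union, and each new factor is the block
  between two chosen stages. It starts at \<open>s 0 = 0\<close> because stage 0 of any
  identification has dimension 1, the empty product.\<close>

lemma inf_tensor_identification_regroup:
  assumes s: "strict_mono s" "s 0 = 0"
  shows "inf_tensor_identification (\<lambda>j. blk (s j) (s (Suc j))) (\<lambda>j. \<iota> (s j))"
proof -
  have le: "s k \<le> s (Suc k)" for k using s(1) by (simp add: strict_mono_less_eq)
  have N: "(\<Prod>l<k. blk (s l) (s (Suc l))) = N (s k)" for k
  proof (induction k)
    case 0
    show ?case by (simp add: s(2) N_def)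
  next
    case (Suc k)
    then show ?case by (simp add: N_blk[OF le[of k]])
  qed
  have "D \<subseteq> (\<Union>k. \<iota> (s k) ` M (s k))"
  proof
    fix x assume "x \<in> D"
    then obtain k a where a: "a \<in> M k" "x = \<iota> k a" by (rule D_cases)
    obtain b where "b \<in> M (s k)" "\<iota> k a = \<iota> (s k) b"
      by (rule D_lift[OF a(1) strict_mono_imp_increasing[OF s(1)]])
    then show "x \<in> (\<Union>k. \<iota> (s k) ` M (s k))" using a(2) by blast
  qed
  then have "closure (\<Union>k. \<iota> (s k) ` M (s k)) = UNIV"
    using closure_mono closure_D by blast
  moreover have "\<iota> (s (Suc k)) (kron a (1\<^sub>m (blk (s k) (s (Suc k))))) = \<iota> (s k) a" if "a \<in> M (s k)" for k a
    using le that by (rule \<iota>_lift)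
  ultimately show ?thesis
    unfolding inf_tensor_identification_def N using embedding by blast
qed

end

text \<open>The index \<open>j\<close> codes a pair whose first entry selects the element, while the
  second is a dummy. Since a code is at least as large as its second entry, large dummies give
  arbitrarily late occurrences.\<close>

lemma enumerate_infinitely_often:
  assumes "countable C" "C \<noteq> {}"
  obtains \<gamma> :: "nat \<Rightarrow> 'b" where "\<And>j. \<gamma> j \<in> C" "\<And>x k. x \<in> C \<Longrightarrow> \<exists>j\<ge>k. \<gamma> j = x"
proof
  let ?\<gamma> = "\<lambda>j. from_nat_into C (fst (prod_decode j))"
  show "?\<gamma> j \<in> C" for j using assms(2) by (rule from_nat_into)
  show "\<exists>j\<ge>k. ?\<gamma> j = x" if "x \<in> C" for x k
  proof -
    have "x \<in> range (from_nat_into C)"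
      unfolding range_from_nat_into[OF assms(2,1)] by (rule that)
    then obtain i where "x = from_nat_into C i" by (rule rangeE)
    then have "?\<gamma> (prod_encode (i, k)) = x" by simp
    then show ?thesis using le_prod_encode_2 by blast
  qed
qed

section \<open>The action and its strong outerness\<close>

theorem theorem3p6:
  fixes G :: "('g, 'm) monoid_scheme"
  assumes "group G" and "countable (carrier G)" and "maximally_almost_periodic G"
    and "uhf_algebra TYPE('a::cstar_algebra)"
  shows "\<exists>\<alpha> :: 'g \<Rightarrow> 'a \<Rightarrow> 'a. product_type_action G \<alpha> \<and> strongly_outer G \<alpha>"
proof -
  interpret group G by fact
  obtain n and \<iota> :: "nat \<Rightarrow> complex mat \<Rightarrow> 'a" where n: "\<And>l. n l \<ge> 2"
    and \<iota>: "inf_tensor_identification n \<iota>"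
    using assms(4) unfolding uhf_algebra_def by blast
  interpret A: tensor_identification n \<iota>
    by unfold_locales (use n \<iota> le_trans[OF one_le_numeral] in auto)
  have "\<exists>d \<phi>. \<phi> \<in> hom G (unitary_group d) \<and> (h \<noteq> \<one>\<^bsub>G\<^esub> \<longrightarrow> \<phi> h \<noteq> 1\<^sub>m d)" if "h \<in> carrier G" for h
  proof (cases "h = \<one>\<^bsub>G\<^esub>")
    \<comment> \<open>The identity of G also occurs in the enumeration but has nothing to detect.
      Its filler is the zero-dimensional representation, for which \<open>amplify\<close> has no
      copies (as \<open>N div 0 = 0\<close>) and returns the identity matrix.\<close>
    case True
    have "(\<lambda>_. 1\<^sub>m 0) \<in> hom G (unitary_group 0)"
      by (rule homI) (simp_all add: unitary_group_def)
    then show ?thesis using True by blast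
  next
    case False
    then show ?thesis
      using assms(3) that unfolding maximally_almost_periodic_def
      by (auto simp: unitary_group_def Bex_def)
  qed
  then obtain d \<phi> where hom: "\<And>h. h \<in> carrier G \<Longrightarrow> \<phi> h \<in> hom G (unitary_group (d h))"
    and nontriv: "\<And>h. h \<in> carrier G \<Longrightarrow> h \<noteq> \<one>\<^bsub>G\<^esub> \<Longrightarrow> \<phi> h h \<noteq> 1\<^sub>m (d h)"
    by metis
  obtain \<gamma> :: "nat \<Rightarrow> 'g" where \<gamma>: "\<And>j. \<gamma> j \<in> carrier G" and inf: "\<And>h k. h \<in> carrier G \<Longrightarrow> \<exists>j\<ge>k. \<gamma> j = h"
  proof (rule enumerate_infinitely_often[OF assms(2)])
    show "carrier G \<noteq> {}" using one_closed by blast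
    fix \<gamma> :: "nat \<Rightarrow> 'g"
    assume "\<And>j. \<gamma> j \<in> carrier G" "\<And>h k. h \<in> carrier G \<Longrightarrow> \<exists>j\<ge>k. \<gamma> j = h"
    then show thesis by (rule that)
  qed
  \<comment> \<open>Block \<open>j\<close> takes \<open>2 * d (\<gamma> j) + 1\<close> factors. Each
    has dimension at least 2, so the block has dimension at least 2^(2 d + 1), which exceeds 2 d;
    the extra 1 keeps \<open>s\<close> strictly increasing when the representation has dimension
    0.\<close>
  define s where "s = rec_nat 0 (\<lambda>j m. m + Suc (2 * d (\<gamma> j)))"
  have s0: "s 0 = 0" and s_Suc: "s (Suc j) = s j + Suc (2 * d (\<gamma> j))" for j by (simp_all add: s_def)
  have s_mono: "strict_mono s" by (rule strict_mono_Suc_iff[THEN iffD2]) (simp add: s_Suc)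
  define n' where "n' j = A.blk (s j) (s (Suc j))" for j
  have n'_ge: "2 * d (\<gamma> j) \<le> n' j" for j
  proof -
    have "2 ^ card {s j..<s (Suc j)} \<le> n' j"
      unfolding n'_def A.blk_def using prod_mono[of "{s j..<s (Suc j)}" "\<lambda>_. 2" n] n by simp
    then have "2 ^ Suc (2 * d (\<gamma> j)) \<le> n' j" by (simp add: s_Suc)
    moreover have "2 * d (\<gamma> j) < 2 ^ (2 * d (\<gamma> j))" by (rule less_exp)
    ultimately show ?thesis unfolding power_Suc by linarith
  qed
  interpret B: tensor_identification n' "\<lambda>j. \<iota> (s j)"
  proof
    show "1 \<le> n' l" for l unfolding n'_def using A.blk_pos[of "s l" "s (Suc l)"] by simp
    show "inf_tensor_identification n' (\<lambda>j. \<iota> (s j))"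
      unfolding n'_def by (rule A.inf_tensor_identification_regroup[OF s_mono s0])
  qed
  define \<rho> where "\<rho> g = (\<lambda>j. amplify (d (\<gamma> j)) (n' j) (\<phi> (\<gamma> j) g))" for g
  have comp: "(\<lambda>g. \<rho> g j) \<in> hom G (unitary_group (n' j))" for j
    unfolding \<rho>_def by (rule amplify_hom[OF hom[OF \<gamma>]])
  have \<rho>_unitary: "\<rho> g j \<in> carrier (unitary_group (n' j))" if "g \<in> carrier G" for g j
    using hom_in_carrier[OF comp that] .
  have \<rho>: "\<rho> \<in> hom G (product_group UNIV (\<lambda>l. unitary_group (n' l)))"
  proof (rule homI)
    fix g h assume gh: "g \<in> carrier G" "h \<in> carrier G"
    show "\<rho> (g \<otimes>\<^bsub>G\<^esub> h) = \<rho> g \<otimes>\<^bsub>product_group UNIV (\<lambda>l. unitary_group (n' l))\<^esub> \<rho> h"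
      using hom_mult[OF comp gh] by (simp add: product_group_def restrict_UNIV fun_eq_iff)
  qed (auto simp: PiE_iff \<rho>_unitary)
  have "\<not> weakly_inner the_trace (B.Ad_lim (\<rho> g))" if g: "g \<in> carrier G" "g \<noteq> \<one>\<^bsub>G\<^esub>" for g
  proof -
    let ?v = "\<phi> g g" and ?d = "d g"
    have v: "?v \<in> carrier_mat ?d ?d"
      by (rule unitary_groupD(1)[OF hom_in_carrier[OF hom[OF g(1)] g(1)]])
    \<comment> \<open>In dimension 0 every matrix is the identity, so a representation that detects
      \<open>g\<close> has positive dimension.\<close>
    have d: "?d > 0"
    proof (rule ccontr)
      assume "\<not> ?d > 0"
      then have "?v = 1\<^sub>m ?d" using v by (intro eq_matI) auto
      then show False using nontriv[OF g] by simp
    qed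
    \<comment> \<open>Depends on \<open>g\<close> alone and not on the block, so the same bound
      holds at each of the infinitely many occurrences of \<open>g\<close>. It bounds a squared
      seminorm, hence \<delta> below is its root.\<close>
    define c where "c = hs_sq (1\<^sub>m ?d - ?v) / (4 * real ?d)"
    have c: "c > 0"
      unfolding c_def using hs_sq_pos[OF one_carrier_mat v] nontriv[OF g] d by fastforce
    show ?thesis
    proof (rule B.not_weakly_inner_Ad_lim[where \<delta> = "sqrt c"])
      show "B.unitary_seq (\<rho> g)" unfolding B.unitary_seq_def using \<rho>_unitary[OF g(1)] by blast
      show "sqrt c > 0" using c by simp
      fix k
      obtain j where j: "j \<ge> k" "\<gamma> j = g" using inf[OF g(1)] by blast
      have u: "\<rho> g j = amplify ?d (n' j) ?v" by (simp add: \<rho>_def j(2))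
      have le: "2 * ?d \<le> n' j" using n'_ge[of j] by (simp add: j(2))
      obtain b where "b \<in> carrier (unitary_group (n' j))"
        "c \<le> hs_sq (b - \<rho> g j * b * mat_adjoint (\<rho> g j)) / real (n' j)"
        unfolding u c_def by (rule amplify_defect[OF v d le])
      then show "\<exists>j\<ge>k. \<exists>b\<in>carrier (unitary_group (n' j)).
          (sqrt c)\<^sup>2 \<le> hs_sq (b - \<rho> g j * b * mat_adjoint (\<rho> g j)) / real (n' j)"
        using j c by auto
    qed
  qed
  then have "strongly_outer G (\<lambda>g. B.Ad_lim (\<rho> g))"
    unfolding strongly_outer_def by blast
  then show ?thesis using B.product_type_action_Ad_lim[OF \<rho>] by blast
qed

end
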